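(* Let $G$ be a group acting geometrically (properly discontinuously and cocompactly by isometries) on a proper geodesic metric space $X$, and let $g\in G$ be an element of infinite order. Then the following are equivalent: (1) $\mathrm{Fix}_{\partial_M X}(g)$ is nonempty. (2) For some $x_0\in X$ (hence for any $x_0\in X$), there exists a Morse gauge $N_0$, depending only on $x_0$ and $g$, such that the geodesic $[x_0,g^k(x_0)]$ is $N_0$-Morse for every $k\in\mathbb{Z}$. (3) Letting $\eta=[x_0,g(x_0)]$ be a geodesic, the bi-infinite path $\eta_{-\infty}^{+\infty}=\bigcup_{k\in\mathbb{Z}}g^k(\eta)$ is a Morse quasi-geodesic. In particular, $g$ is a Morse isometry. (4) $\mathrm{Fix}_{\partial_M X}(g)$ contains two distinct points.
   Context: A Morse gauge is a function $N:[1,\infty)\times[0,\infty)\to[0,\infty)$. A (quasi-)geodesic $\gamma$ in $X$ is $N$-Morse if every $(\lambda,\epsilon)$-quasi-geodesic with endpoints on $\gamma$ lies in the $N(\lambda,\epsilon)$-neighborhood of $\gamma$; it is Morse if it is $N$-Morse for some $N$. The Morse boundary $\partial_M X$ is the set of equivalence classes of Morse geodesic rays in $X$, two rays being equivalent if their Hausdorff distance is finite (for a basepoint $x_0$, each class contains a Morse ray based at $x_0$). An isometry $g$ of $X$ acts on $\partial_M X$ by $[\alpha]\mapsto[g\circ\alpha]$, and $\mathrm{Fix}_{\partial_M X}(g)$ denotes the set of points of $\partial_M X$ fixed by $g$. For $x_n=g^n(x_0)$, an isometry $g$ is called Morse if there are a Morse gauge $N$ and geodesics $[x_i,x_{i+1}]$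 ($i\in\mathbb{Z}$) such that the bi-infinite concatenation $\bigcup_i[x_i,x_{i+1}]$ (parametrized by arc length) is an $N$-Morse quasi-geodesic. *)

theory Defs
  imports "HOL-Analysis.Analysis" "HOL-Algebra.Group_Action"
begin

definition proper_space :: "'a::metric_space itself \<Rightarrow> bool" where
  "proper_space _ \<longleftrightarrow> (\<forall>(x::'a) r. compact (cball x r))"

definition geodesic_from :: "'a::metric_space \<Rightarrow> 'a \<Rightarrow> (real \<Rightarrow> 'a) \<Rightarrow> bool" where
  "geodesic_from x y \<gamma> \<longleftrightarrow> \<gamma> 0 = x \<and> \<gamma> (dist x y) = y \<and>
     (\<forall>s\<in>{0..dist x y}. \<forall>t\<in>{0..dist x y}. dist (\<gamma> s) (\<gamma> t) = \<bar>s - t\<bar>)"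

definition geodesic_space :: "'a::metric_space itself \<Rightarrow> bool" where
  "geodesic_space _ \<longleftrightarrow> (\<forall>x y::'a. \<exists>\<gamma>. geodesic_from x y \<gamma>)"

definition geodesic_ray :: "(real \<Rightarrow> 'a::metric_space) \<Rightarrow> bool" where
  "geodesic_ray \<gamma> \<longleftrightarrow> (\<forall>s\<ge>0. \<forall>t\<ge>0. dist (\<gamma> s) (\<gamma> t) = \<bar>s - t\<bar>)"

definition quasi_geodesic_on :: "real \<Rightarrow> real \<Rightarrow> real set \<Rightarrow> (real \<Rightarrow> 'a::metric_space) \<Rightarrow> bool" where
  "quasi_geodesic_on lam eps I q \<longleftrightarrow> is_interval I \<and>
     (\<forall>s\<in>I. \<forall>t\<in>I. \<bar>s - t\<bar> / lam - eps \<le> dist (q s) (q t) \<and> dist (q s) (q t) \<le> lam * \<bar>s - t\<bar> + eps)"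

definition morse_gauge :: "(real \<Rightarrow> real \<Rightarrow> real) \<Rightarrow> bool" where
  "morse_gauge N \<longleftrightarrow> (\<forall>lam\<ge>1. \<forall>eps\<ge>0. N lam eps \<ge> 0)"

definition N_morse_on :: "(real \<Rightarrow> real \<Rightarrow> real) \<Rightarrow> real set \<Rightarrow> (real \<Rightarrow> 'a::metric_space) \<Rightarrow> bool" where
  "N_morse_on N I f \<longleftrightarrow>
     (\<forall>lam eps a b q. lam \<ge> 1 \<longrightarrow> eps \<ge> 0 \<longrightarrow> a \<le> b \<longrightarrow>
        quasi_geodesic_on lam eps {a..b} q \<longrightarrow> q a \<in> f ` I \<longrightarrow> q b \<in> f ` I \<longrightarrow>
        (\<forall>t\<in>{a..b}. \<exists>s\<in>I. dist (q t) (f s) \<le> N lam eps))"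

definition morse_on :: "real set \<Rightarrow> (real \<Rightarrow> 'a::metric_space) \<Rightarrow> bool" where
  "morse_on I f \<longleftrightarrow> (\<exists>N. morse_gauge N \<and> N_morse_on N I f)"

definition morse_quasi_geodesic_on :: "real set \<Rightarrow> (real \<Rightarrow> 'a::metric_space) \<Rightarrow> bool" where
  "morse_quasi_geodesic_on I f \<longleftrightarrow>
     (\<exists>lam eps. lam \<ge> 1 \<and> eps \<ge> 0 \<and> quasi_geodesic_on lam eps I f) \<and> morse_on I f"

definition morse_rays :: "(real \<Rightarrow> 'a::metric_space) set" where
  "morse_rays = {\<alpha>. geodesic_ray \<alpha> \<and> morse_on {0..} \<alpha>}"

definition finite_hausdorff_rays :: "(real \<Rightarrow> 'a::metric_space) \<Rightarrow> (real \<Rightarrow> 'a) \<Rightarrow> bool" where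
  "finite_hausdorff_rays \<alpha> \<beta> \<longleftrightarrow> (\<exists>D. (\<forall>s\<ge>0. \<exists>t\<ge>0. dist (\<alpha> s) (\<beta> t) \<le> D) \<and>
                                       (\<forall>t\<ge>0. \<exists>s\<ge>0. dist (\<alpha> s) (\<beta> t) \<le> D))"

definition ray_equiv :: "((real \<Rightarrow> 'a::metric_space) \<times> (real \<Rightarrow> 'a)) set" where
  "ray_equiv = {(\<alpha>, \<beta>). \<alpha> \<in> morse_rays \<and> \<beta> \<in> morse_rays \<and> finite_hausdorff_rays \<alpha> \<beta>}"

definition morse_boundary :: "(real \<Rightarrow> 'a::metric_space) set set" where
  "morse_boundary = morse_rays // ray_equiv"

definition boundary_act :: "('a \<Rightarrow> 'a) \<Rightarrow> (real \<Rightarrow> 'a) set \<Rightarrow> (real \<Rightarrow> 'a) set" where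
  "boundary_act h C = (\<lambda>\<alpha>. h \<circ> \<alpha>) ` C"

definition Fix_morse_boundary :: "('a::metric_space \<Rightarrow> 'a) \<Rightarrow> (real \<Rightarrow> 'a) set set" where
  "Fix_morse_boundary h = {C \<in> morse_boundary. boundary_act h C = C}"

definition geometric_action :: "('g, 'b) monoid_scheme \<Rightarrow> ('g \<Rightarrow> 'a::metric_space \<Rightarrow> 'a) \<Rightarrow> bool" where
  "geometric_action G \<phi> \<longleftrightarrow>
     group_action G UNIV \<phi> \<and>
     (\<forall>g\<in>carrier G. \<forall>x y. dist (\<phi> g x) (\<phi> g y) = dist x y) \<and>
     (\<forall>K. compact K \<longrightarrow> finite {g \<in> carrier G. \<phi> g ` K \<inter> K \<noteq> {}}) \<and>
     (\<exists>K. compact K \<and> (\<Union>g\<in>carrier G. \<phi> g ` K) = UNIV)"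

text \<open>Concatenation \<Union>_i [x_i, x_{i+1}] of geodesics \<gamma> i from x_i to x_{i+1}, each of length L,
  parametrised by arc length: on [iL, (i+1)L) it follows \<gamma> i.\<close>
definition concat_path :: "real \<Rightarrow> (int \<Rightarrow> real \<Rightarrow> 'a) \<Rightarrow> real \<Rightarrow> 'a" where
  "concat_path L \<gamma> t = (let i = \<lfloor>t / L\<rfloor> in \<gamma> i (t - of_int i * L))"

definition morse_isometry_wrt :: "('g, 'b) monoid_scheme \<Rightarrow> ('g \<Rightarrow> 'a::metric_space \<Rightarrow> 'a) \<Rightarrow> 'g \<Rightarrow> 'a \<Rightarrow> bool" where
  "morse_isometry_wrt G \<phi> g x0 \<longleftrightarrow>
     (\<exists>N \<gamma>. morse_gauge N \<and>
        (\<forall>i::int. geodesic_from (\<phi> (g [^]\<^bsub>G\<^esub> i) x0) (\<phi> (g [^]\<^bsub>G\<^esub> (i + 1)) x0) (\<gamma> i)) \<and>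
        (\<exists>lam eps. lam \<ge> 1 \<and> eps \<ge> 0 \<and>
           quasi_geodesic_on lam eps UNIV (concat_path (dist x0 (\<phi> g x0)) \<gamma>)) \<and>
        N_morse_on N UNIV (concat_path (dist x0 (\<phi> g x0)) \<gamma>))"

end

theory Submission
  imports Defs
begin

text \<open>A geodesic between \<open>x0\<close> and \<open>g\<^sup>k x0\<close> is the side of an ideal triangle whose other two sides
  are an \<open>N\<close>-Morse ray \<open>\<alpha>\<close> in the fixed class and its translate \<open>g\<^sup>k \<alpha>\<close>; hence it is Morse with
  a gauge independent of \<open>k\<close>. Conversely, uniformly Morse geodesics from \<open>x0\<close> to \<open>g\<^sup>k x0\<close>
  subconverge to a Morse ray that \<open>g\<close> moves by a bounded amount.

  The orbit of \<open>g\<close> is undistorted: far out, \<open>g\<^sup>k \<alpha>\<close> coincides with \<open>\<alpha>\<close> shifted by some \<open>c k\<close>, up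
  to an error depending only on \<open>N\<close>. So \<open>c\<close> is a quasimorphism on the integers. It is unbounded,
  since otherwise arbitrarily many powers of \<open>g\<close> would move a far point of \<open>\<alpha>\<close> by a bounded
  amount, which cocompactness and proper discontinuity forbid; thus it grows linearly. An orbit path is
  therefore a quasi-geodesic close to Morse geodesics, so it is Morse, and its two ends are
  distinct fixed points.\<close>

subsection \<open>Quasi-geodesics near Morse quasi-geodesics\<close>

text \<open>Quasi-geodesics are not assumed continuous, so intermediate-value and closest-point
  arguments are run with unit steps of the parameter and with closest points up to an error of 1.
  The Morse property is mostly transferred by one criterion: a quasi-geodesic is Morse as soon as
  any two of its points lie near some Morse quasi-geodesic with common constants and gauge, which
  may change with the pair. This is what lets it pass to limits, to sides of triangles and to orbit
  paths. The obstacle to uniformity in \<open>k\<close> is that the Hausdorff distance from \<alpha>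
  to its translate by \<open>g^k\<close> is finite but comes without a bound in \<open>k\<close>.
  Closing up a stretch of one ray by geodesics from almost closest points gives a quasi-geodesic
  with endpoints on the other ray. Each closing changes \<open>(lam, eps)\<close> into
  \<open>(3 * lam, eps + 2)\<close>, so two of them lead from \<open>(1, 0)\<close> to
  \<open>(9, 4)\<close>; hence the constant \<open>N 9 4\<close>, in which neither that distance nor
  \<open>k\<close> appears.\<close>

lemma dist_perturb:
  assumes "dist x x' \<le> d" "dist y y' \<le> e"
  shows "\<bar>dist x y - dist x' y'\<bar> \<le> d + e"
  using assms by metric

lemma quasi_geodesic_onD:
  assumes "quasi_geodesic_on lam eps I q" "s \<in> I" "t \<in> I"
  shows "\<bar>s - t\<bar> / lam - eps \<le> dist (q s) (q t)" "dist (q s) (q t) \<le> lam * \<bar>s - t\<bar> + eps"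
  using assms by (auto simp: quasi_geodesic_on_def)

lemma quasi_geodesic_on_param_dist:
  assumes "quasi_geodesic_on lam eps I q" "s \<in> I" "t \<in> I" "lam \<ge> 1"
  shows "\<bar>s - t\<bar> \<le> lam * (dist (q s) (q t) + eps)"
  using quasi_geodesic_onD(1)[OF assms(1-3)] assms(4) by (simp add: field_simps)

lemma quasi_geodesic_on_subset:
  assumes "quasi_geodesic_on lam eps I q" "J \<subseteq> I" "is_interval J"
  shows "quasi_geodesic_on lam eps J q"
  using assms unfolding quasi_geodesic_on_def by blast

lemma quasi_geodesic_on_reverse:
  assumes "quasi_geodesic_on lam eps {a..b} q"
  shows "quasi_geodesic_on lam eps {-b..-a} (\<lambda>t. q (- t))"
  unfolding quasi_geodesic_on_def
proof (intro conjI ballI)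
  fix s t assume "s \<in> {-b..-a}" "t \<in> {-b..-a}"
  then have m: "- s \<in> {a..b}" "- t \<in> {a..b}" by auto
  have e: "\<bar>- s - - t\<bar> = \<bar>s - t\<bar>" by simp
  show "\<bar>s - t\<bar> / lam - eps \<le> dist (q (- s)) (q (- t))"
    "dist (q (- s)) (q (- t)) \<le> lam * \<bar>s - t\<bar> + eps"
    using quasi_geodesic_onD[OF assms m] unfolding e by auto
qed (simp add: is_interval_cc)

lemma quasi_geodesic_on_perturb:
  assumes q: "quasi_geodesic_on lam eps {a..b} q" and "lam \<ge> 1" "eps \<ge> 0" "R \<ge> 0"
    and p: "\<And>t. t \<in> {a..b} \<Longrightarrow> dist (p t) (q t) \<le> R"
  shows "quasi_geodesic_on lam (eps + 2 * R) {a..b} p"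
  unfolding quasi_geodesic_on_def
proof (intro conjI ballI)
  fix s t assume m: "s \<in> {a..b}" "t \<in> {a..b}"
  have "\<bar>dist (p s) (p t) - dist (q s) (q t)\<bar> \<le> R + R"
    by (intro dist_perturb p m)
  then show "\<bar>s - t\<bar> / lam - (eps + 2 * R) \<le> dist (p s) (p t)"
    "dist (p s) (p t) \<le> lam * \<bar>s - t\<bar> + (eps + 2 * R)"
    using quasi_geodesic_onD[OF q m] by linarith+
qed (simp add: is_interval_cc)

lemma geodesic_from_quasi_geodesic:
  "geodesic_from x y \<gamma> \<Longrightarrow> quasi_geodesic_on 1 0 {0..dist x y} \<gamma>"
  by (auto simp: quasi_geodesic_on_def geodesic_from_def is_interval_cc)

lemma geodesic_ray_quasi_geodesic: "geodesic_ray \<alpha> \<Longrightarrow> quasi_geodesic_on 1 0 {0..} \<alpha>"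
  by (auto simp: quasi_geodesic_on_def geodesic_ray_def is_interval_ci)

text \<open>Quasi-geodesics need not be continuous, so endpoints lying near the path can be moved onto it.\<close>

lemma N_morse_on_near_endpoints:
  assumes f: "N_morse_on N I f" "morse_gauge N"
    and q: "quasi_geodesic_on lam eps {a..b} q" "lam \<ge> 1" "eps \<ge> 0" "R \<ge> 0"
    and a: "\<exists>s\<in>I. dist (q a) (f s) \<le> R" and b: "\<exists>s\<in>I. dist (q b) (f s) \<le> R"
    and t: "t \<in> {a..b}"
  shows "\<exists>s\<in>I. dist (q t) (f s) \<le> N lam (eps + 2 * R) + R"
proof -
  obtain s1 s2 where s1: "s1 \<in> I" "dist (q a) (f s1) \<le> R" and s2: "s2 \<in> I" "dist (q b) (f s2) \<le> R"
    using a b by blast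
  have N0: "N lam (eps + 2 * R) \<ge> 0" using f(2) q by (auto simp: morse_gauge_def)
  consider "t = a" | "t = b" | "a < t" "t < b" using t by fastforce
  then show ?thesis
  proof cases
    case 3
    define p where "p = q(a := f s1, b := f s2)"
    have "quasi_geodesic_on lam (eps + 2 * R) {a..b} p"
      using s1 s2 q by (intro quasi_geodesic_on_perturb[of _ _ _ _ q]) (auto simp: p_def dist_commute)
    moreover have "p a \<in> f ` I" "p b \<in> f ` I" "p t = q t" using s1 s2 3 by (auto simp: p_def)
    moreover have "a \<le> b" "eps + 2 * R \<ge> 0" using 3 q by auto
    ultimately obtain s where "s \<in> I" "dist (q t) (f s) \<le> N lam (eps + 2 * R)"
      using f(1) t q(2) unfolding N_morse_on_def by metis
    then show ?thesis using q(4) by force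
  qed (use s1 s2 N0 in force)+
qed

text \<open>Stand-in for connectedness of the interval. On a walk from \<open>a\<close> in unit
  steps, capped at \<open>b\<close>, the property \<open>P\<close> would persist up to
  \<open>b\<close> if there were no crossing, and then \<open>t = t' = b\<close> is one.\<close>

lemma discrete_crossing:
  fixes a b :: real
  assumes ab: "a \<le> b" and "P a" "Q b" and PQ: "\<And>t. t \<in> {a..b} \<Longrightarrow> P t \<or> Q t"
  shows "\<exists>t\<in>{a..b}. \<exists>t'\<in>{a..b}. \<bar>t - t'\<bar> \<le> 1 \<and> P t \<and> Q t'"
proof (rule ccontr)
  assume *: "\<not> ?thesis"
  have "P (min b (a + real n))" for n
  proof (induction n)
    case 0 then show ?case using assms by simp
  next
    case (Suc n)
    have "min b (a + real n) \<in> {a..b}" "min b (a + real (Suc n)) \<in> {a..b}"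
      "\<bar>min b (a + real n) - min b (a + real (Suc n))\<bar> \<le> 1" using ab by (auto simp: min_def)
    then show ?case using * PQ Suc by blast
  qed
  moreover obtain n where "real n \<ge> b - a" using real_arch_simple by blast
  ultimately have "P b" by (metis add.commute diff_le_eq min.absorb1)
  then show False using * assms by force
qed

text \<open>Each point of \<open>q\<close> is near \<open>f\<close> at a parameter on one side of
  \<open>s\<close>. At a crossing, points of \<open>q\<close> at most 1 apart in parameter are near
  \<open>f u\<close> and \<open>f u'\<close> with \<open>u \<le> s \<le> u'\<close>; the lower bound
  for \<open>f\<close> keeps \<open>u\<close> and \<open>u'\<close> together, and \<open>s\<close>
  with them.\<close>

lemma quasi_geodesic_passes_near:
  assumes f: "quasi_geodesic_on l0 e0 I f" "l0 \<ge> 1" "e0 \<ge> 0"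
    and q: "quasi_geodesic_on lam eps {a..b} q" "lam \<ge> 1" "a \<le> b"
    and near: "\<And>t. t \<in> {a..b} \<Longrightarrow> \<exists>u\<in>I. dist (q t) (f u) \<le> R"
    and s: "s1 \<in> I" "s2 \<in> I" "s1 \<le> s" "s \<le> s2"
    and "dist (q a) (f s1) \<le> R" "dist (q b) (f s2) \<le> R"
  shows "\<exists>t\<in>{a..b}. dist (q t) (f s) \<le> R + l0 * (l0 * (2 * R + lam + eps + e0)) + e0"
proof -
  let ?P = "\<lambda>t. \<exists>u\<in>I. u \<le> s \<and> dist (q t) (f u) \<le> R"
  let ?Q = "\<lambda>t. \<exists>u\<in>I. s \<le> u \<and> dist (q t) (f u) \<le> R"
  have "\<exists>t\<in>{a..b}. \<exists>t'\<in>{a..b}. \<bar>t - t'\<bar> \<le> 1 \<and> ?P t \<and> ?Q t'"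
    by (rule discrete_crossing) (use assms in \<open>auto, meson linear\<close>)
  then obtain t t' u u' where t: "t \<in> {a..b}" "t' \<in> {a..b}" "\<bar>t - t'\<bar> \<le> 1"
    and u: "u \<in> I" "u \<le> s" "dist (q t) (f u) \<le> R" "u' \<in> I" "s \<le> u'" "dist (q t') (f u') \<le> R"
    by blast
  have sI: "s \<in> I" using f(1) s unfolding quasi_geodesic_on_def is_interval_1 by blast
  have "dist (q t) (q t') \<le> lam * \<bar>t - t'\<bar> + eps" using quasi_geodesic_onD[OF q(1) t(1,2)] by simp
  also have "\<dots> \<le> lam + eps" using mult_left_mono[OF t(3), of lam] q(2) by simp
  finally have "dist (f u) (f u') \<le> 2 * R + lam + eps" using u by metric
  then have "l0 * (dist (f u) (f u') + e0) \<le> l0 * (2 * R + lam + eps + e0)"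
    using f(2) by (intro mult_left_mono) auto
  then have "\<bar>u - u'\<bar> \<le> l0 * (2 * R + lam + eps + e0)"
    using quasi_geodesic_on_param_dist[OF f(1) u(1,4) f(2)] by linarith
  then have "\<bar>u - s\<bar> \<le> l0 * (2 * R + lam + eps + e0)" using u by linarith
  then have "l0 * \<bar>u - s\<bar> \<le> l0 * (l0 * (2 * R + lam + eps + e0))"
    using f(2) by (intro mult_left_mono) auto
  then have "dist (f u) (f s) \<le> l0 * (l0 * (2 * R + lam + eps + e0)) + e0"
    using quasi_geodesic_onD(2)[OF f(1) u(1) sI] by linarith
  then have "dist (q t) (f s) \<le> R + l0 * (l0 * (2 * R + lam + eps + e0)) + e0"
    using u(3) dist_triangle[of "q t" "f s" "f u"] by linarith
  then show ?thesis using t by blast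
qed

text \<open>\<open>R1\<close> is the Morse bound after moving the endpoints onto \<open>f\<close>,
  and \<open>R2\<close> the distance at which \<open>q\<close> passes each point of
  \<open>f\<close>. The remaining terms bound how far \<open>q\<close> strays between an endpoint
  and such a passage.\<close>

definition fellow_bound ::
    "(real \<Rightarrow> real \<Rightarrow> real) \<Rightarrow> real \<Rightarrow> real \<Rightarrow> real \<Rightarrow> real \<Rightarrow> real \<Rightarrow> real" where
  "fellow_bound N l0 e0 lam eps R =
    (let R1 = N lam (eps + 2 * R) + R; R2 = R1 + l0 * (l0 * (2 * R1 + lam + eps + e0)) + e0
     in R2 + (lam * (lam * (R2 + R + eps)) + eps) + R)"

text \<open>The Morse property puts \<open>q t\<close> near \<open>f\<close> somewhere in
  \<open>I\<close>, possibly beyond \<open>s1\<close> or \<open>s2\<close>. An overshoot before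
  \<open>s1\<close> forces \<open>q\<close> to pass \<open>f s1\<close> at a later time
  \<open>t'\<close>; then \<open>t\<close> lies between \<open>a\<close> and \<open>t'\<close>, at
  both of which \<open>q\<close> is near \<open>f s1\<close>, and a quasi-geodesic cannot stray far
  in between.\<close>

lemma morse_fellow_travel:
  assumes N: "morse_gauge N" and c: "l0 \<ge> 1" "e0 \<ge> 0" "lam \<ge> 1" "eps \<ge> 0" "R \<ge> 0"
    and f: "quasi_geodesic_on l0 e0 I f" "N_morse_on N I f"
    and q: "quasi_geodesic_on lam eps {a..b} q" "a \<le> b"
    and s: "s1 \<in> I" "s2 \<in> I" "s1 \<le> s2" and d: "dist (q a) (f s1) \<le> R" "dist (q b) (f s2) \<le> R"
  shows "t \<in> {a..b} \<Longrightarrow> \<exists>s\<in>{s1..s2}. dist (q t) (f s) \<le> fellow_bound N l0 e0 lam eps R"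
    and "s \<in> {s1..s2} \<Longrightarrow> \<exists>t\<in>{a..b}. dist (q t) (f s) \<le> fellow_bound N l0 e0 lam eps R"
proof -
  define R1 where "R1 = N lam (eps + 2 * R) + R"
  define R2 where "R2 = R1 + l0 * (l0 * (2 * R1 + lam + eps + e0)) + e0"
  define K where "K = lam * (lam * (R2 + R + eps)) + eps"
  have bound: "fellow_bound N l0 e0 lam eps R = R2 + K + R"
    by (simp add: fellow_bound_def Let_def K_def R2_def R1_def)
  have N0: "N lam (eps + 2 * R) \<ge> 0" using N c by (auto simp: morse_gauge_def)
  then have R1: "R \<le> R1" "0 \<le> R1" using c by (auto simp: R1_def)
  have "0 \<le> l0 * (l0 * (2 * R1 + lam + eps + e0))" using c R1 by simp
  then have R2: "R1 \<le> R2" "0 \<le> R2" using c R1 by (auto simp: R2_def)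
  have "0 \<le> lam * (lam * (R2 + R + eps))" using c R2 by simp
  then have K: "0 \<le> K" using c by (simp add: K_def)
  have near: "\<exists>u\<in>I. dist (q t) (f u) \<le> R1" if "t \<in> {a..b}" for t
    unfolding R1_def using that s d
    by (intro N_morse_on_near_endpoints[OF f(2) N q(1) c(3-5)]) auto
  have pass: "\<exists>t\<in>{a'..b'}. dist (q t) (f u) \<le> R2"
    if "a \<le> a'" "a' \<le> b'" "b' \<le> b" "u1 \<in> I" "u2 \<in> I" "u1 \<le> u" "u \<le> u2"
      "dist (q a') (f u1) \<le> R1" "dist (q b') (f u2) \<le> R1" for a' b' u1 u2 u
    unfolding R2_def
  proof (rule quasi_geodesic_passes_near[OF f(1) c(1,2) _ c(3) that(2) _ that(4-9)])
    show "quasi_geodesic_on lam eps {a'..b'} q"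
      by (rule quasi_geodesic_on_subset[OF q(1)]) (use that in \<open>auto simp: is_interval_cc\<close>)
  qed (use near that in auto)
  have drift: "dist (q t) (f s) \<le> R2 + K + R"
    if "t \<in> {a..b}" "t' \<in> {a..b}" "e \<in> {a..b}" "\<bar>t - e\<bar> \<le> \<bar>t' - e\<bar>"
      "dist (q t') (f s) \<le> R2" "dist (q e) (f s) \<le> R" for t t' e s
  proof -
    have "dist (q t') (q e) + eps \<le> R2 + R + eps"
      using that(5,6) dist_triangle2[of "q t'" "q e" "f s"] by linarith
    then have "lam * (dist (q t') (q e) + eps) \<le> lam * (R2 + R + eps)"
      using c by (intro mult_left_mono) auto
    then have "\<bar>t - e\<bar> \<le> lam * (R2 + R + eps)"
      using quasi_geodesic_on_param_dist[OF q(1) that(2,3) c(3)] that(4) by linarith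
    then have "lam * \<bar>t - e\<bar> \<le> lam * (lam * (R2 + R + eps))"
      using c by (intro mult_left_mono) auto
    then have "dist (q t) (q e) \<le> K"
      using quasi_geodesic_onD(2)[OF q(1) that(1,3)] by (simp add: K_def)
    then show ?thesis using that(6) R2 dist_triangle[of "q t" "f s" "q e"] by linarith
  qed
  show "\<exists>s\<in>{s1..s2}. dist (q t) (f s) \<le> fellow_bound N l0 e0 lam eps R" if t: "t \<in> {a..b}"
    unfolding bound
  proof -
    obtain u where u: "u \<in> I" "dist (q t) (f u) \<le> R1" using near[OF t] by blast
    consider "u \<in> {s1..s2}" | "u < s1" | "s2 < u" by force
    then show "\<exists>s\<in>{s1..s2}. dist (q t) (f s) \<le> R2 + K + R"
    proof cases
      case 1 then show ?thesis using u R2 K c by force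
    next
      case 2
      have "\<exists>t'\<in>{t..b}. dist (q t') (f s1) \<le> R2"
        by (rule pass[of _ _ u s2]) (use 2 u t s d R1 in auto)
      then obtain t' where "t' \<in> {t..b}" "dist (q t') (f s1) \<le> R2" by blast
      then have "dist (q t) (f s1) \<le> R2 + K + R"
        by (intro drift[of t t' a]) (use t d in auto)
      then show ?thesis using s by force
    next
      case 3
      have "\<exists>t'\<in>{a..t}. dist (q t') (f s2) \<le> R2"
        by (rule pass[of _ _ s1 u]) (use 3 u t s d R1 in auto)
      then obtain t' where "t' \<in> {a..t}" "dist (q t') (f s2) \<le> R2" by blast
      then have "dist (q t) (f s2) \<le> R2 + K + R"
        by (intro drift[of t t' b]) (use t d in auto)
      then show ?thesis using s by force
    qed
  qed
  show "\<exists>t\<in>{a..b}. dist (q t) (f s) \<le> fellow_bound N l0 e0 lam eps R" if u: "s \<in> {s1..s2}"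
    unfolding bound
  proof -
    have "\<exists>t\<in>{a..b}. dist (q t) (f s) \<le> R2"
      by (rule pass[of _ _ s1 s2]) (use u s d R1 q(2) in auto)
    then show "\<exists>t\<in>{a..b}. dist (q t) (f s) \<le> R2 + K + R" using K c by force
  qed
qed

text \<open>A point of \<open>q\<close> is sent to \<open>f\<close> with slack \<open>R\<close> and
  from there to \<open>h\<close> with slack \<open>2 * R\<close>, since the ends of \<open>h\<close>
  reach \<open>f\<close> by way of the ends of \<open>q\<close>.\<close>

definition close_gauge ::
    "(real \<Rightarrow> real \<Rightarrow> real) \<Rightarrow> real \<Rightarrow> real \<Rightarrow> real \<Rightarrow> real \<Rightarrow> real \<Rightarrow> real \<Rightarrow> real \<Rightarrow> real" where
  "close_gauge N l0 e0 l1 e1 R lam eps =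
    fellow_bound N l0 e0 lam eps R + fellow_bound N l0 e0 l1 e1 (2 * R)"

lemma fellow_bound_nonneg:
  assumes "morse_gauge N" "l0 \<ge> 1" "e0 \<ge> 0" "lam \<ge> 1" "eps \<ge> 0" "R \<ge> 0"
  shows "fellow_bound N l0 e0 lam eps R \<ge> 0"
proof -
  have "N lam (eps + 2 * R) \<ge> 0" using assms by (auto simp: morse_gauge_def)
  then show ?thesis using assms by (simp add: fellow_bound_def Let_def)
qed

lemma morse_gauge_close_gauge:
  assumes "morse_gauge N" "l0 \<ge> 1" "e0 \<ge> 0" "l1 \<ge> 1" "e1 \<ge> 0" "R \<ge> 0"
  shows "morse_gauge (close_gauge N l0 e0 l1 e1 R)"
  using assms fellow_bound_nonneg unfolding morse_gauge_def[of "close_gauge _ _ _ _ _ _"] close_gauge_def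
  by (auto intro!: add_nonneg_nonneg)

lemma quasi_geodesics_close:
  assumes N: "morse_gauge N"
    and c: "l0 \<ge> 1" "e0 \<ge> 0" "l1 \<ge> 1" "e1 \<ge> 0" "lam \<ge> 1" "eps \<ge> 0" "R \<ge> 0"
    and f: "quasi_geodesic_on l0 e0 I f" "N_morse_on N I f"
    and q: "quasi_geodesic_on lam eps {a..b} q" "a \<le> b" and h: "quasi_geodesic_on l1 e1 {c..d} h" "c \<le> d"
    and qh: "dist (q a) (h c) \<le> R" "dist (q b) (h d) \<le> R"
    and near: "\<exists>s\<in>I. dist (q a) (f s) \<le> R" "\<exists>s\<in>I. dist (q b) (f s) \<le> R" and t: "t \<in> {a..b}"
  shows "\<exists>u\<in>{c..d}. dist (q t) (h u) \<le> close_gauge N l0 e0 l1 e1 R lam eps"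
proof -
  have c2: "0 \<le> 2 * R" using c by simp
  have main: "\<exists>u\<in>{c..d}. dist (q t) (h u) \<le> close_gauge N l0 e0 l1 e1 R lam eps"
    if q: "quasi_geodesic_on lam eps {a..b} q" "a \<le> b" and h: "quasi_geodesic_on l1 e1 {c..d} h" "c \<le> d"
      and qh: "dist (q a) (h c) \<le> R" "dist (q b) (h d) \<le> R"
      and s: "s1 \<in> I" "s2 \<in> I" "s1 \<le> s2" "dist (q a) (f s1) \<le> R" "dist (q b) (f s2) \<le> R"
      and t: "t \<in> {a..b}" for q a b h c d s1 s2 t
  proof -
    obtain s where s': "s \<in> {s1..s2}" "dist (q t) (f s) \<le> fellow_bound N l0 e0 lam eps R"
      using morse_fellow_travel(1)[OF N c(1,2,5,6,7) f q s t] by blast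
    have "dist (h c) (f s1) \<le> 2 * R" "dist (h d) (f s2) \<le> 2 * R"
      using qh s dist_triangle3[of "h c" "f s1" "q a"] dist_triangle3[of "h d" "f s2" "q b"] by linarith+
    then obtain u where "u \<in> {c..d}" "dist (h u) (f s) \<le> fellow_bound N l0 e0 l1 e1 (2 * R)"
      using morse_fellow_travel(2)[OF N c(1,2,3,4) c2 f h s(1-3) _ _ s'(1)] by blast
    then show ?thesis
      using s' dist_triangle2[of "q t" "h u" "f s"] unfolding close_gauge_def by (intro bexI[of _ u]) linarith+
  qed
  obtain s1 s2 where s: "s1 \<in> I" "s2 \<in> I" "dist (q a) (f s1) \<le> R" "dist (q b) (f s2) \<le> R"
    using near by blast
  show ?thesis
  proof (cases "s1 \<le> s2")
    case True
    then show ?thesis using main[OF q h qh s(1,2) _ s(3,4) t] by blast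
  next
    \<comment> \<open>Fellow travelling requires increasing parameters on \<open>f\<close>, so both
      \<open>q\<close> and \<open>h\<close> are reversed.\<close>
    case False
    have "\<exists>u\<in>{-d..-c}. dist (q (- (-t))) (h (-u)) \<le> close_gauge N l0 e0 l1 e1 R lam eps"
      by (rule main[OF quasi_geodesic_on_reverse[OF q(1)] _ quasi_geodesic_on_reverse[OF h(1)], of s2 s1])
        (use False q h qh s t in auto)
    then obtain u where "u \<in> {-d..-c}" "dist (q t) (h (-u)) \<le> close_gauge N l0 e0 l1 e1 R lam eps"
      by auto
    then show ?thesis by (intro bexI[of _ "-u"]) auto
  qed
qed

lemma is_interval_Icc_subset:
  fixes u v :: real
  assumes "is_interval I" "u \<in> I" "v \<in> I" shows "{u..v} \<subseteq> I"
proof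
  fix x assume "x \<in> {u..v}"
  then show "x \<in> I" using mem_is_interval_1_I[OF assms] by simp
qed

text \<open>\<open>J\<close> and \<open>f\<close> may depend on \<open>c\<close> and
  \<open>d\<close>; the constants and the gauge are shared. A quasi-geodesic with endpoints
  \<open>h c\<close> and \<open>h d\<close> and the stretch of \<open>h\<close> between them both
  follow the \<open>f\<close> chosen for this pair.\<close>

lemma morse_of_pairwise_near_morse:
  assumes N: "morse_gauge N" and c: "l0 \<ge> 1" "e0 \<ge> 0" "l1 \<ge> 1" "e1 \<ge> 0" "R \<ge> 0"
    and h: "quasi_geodesic_on l1 e1 I h"
    and near: "\<And>c d. c \<in> I \<Longrightarrow> d \<in> I \<Longrightarrow> \<exists>J f. quasi_geodesic_on l0 e0 J f \<and> N_morse_on N J f \<and>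
       (\<exists>s\<in>J. dist (h c) (f s) \<le> R) \<and> (\<exists>s\<in>J. dist (h d) (f s) \<le> R)"
  shows "N_morse_on (close_gauge N l0 e0 l1 e1 R) I h"
  unfolding N_morse_on_def
proof (intro allI impI ballI)
  fix lam eps :: real and a b q t assume le: "lam \<ge> 1" "eps \<ge> 0"
    and q: "a \<le> b" "quasi_geodesic_on lam eps {a..b} q"
    and e: "q a \<in> h ` I" "q b \<in> h ` I" and t: "t \<in> {a..b}"
  obtain c d where cd: "c \<in> I" "q a = h c" "d \<in> I" "q b = h d" using e by blast
  obtain J f where f: "quasi_geodesic_on l0 e0 J f" "N_morse_on N J f"
    "\<exists>s\<in>J. dist (q a) (f s) \<le> R" "\<exists>s\<in>J. dist (q b) (f s) \<le> R" using near[OF cd(1,3)] cd by auto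
  have int: "is_interval I" using h by (simp add: quasi_geodesic_on_def)
  note close = quasi_geodesics_close[OF N c(1-4) le c(5) f(1,2) q(2,1) _ _ _ _ f(3,4) t]
  show "\<exists>s\<in>I. dist (q t) (h s) \<le> close_gauge N l0 e0 l1 e1 R lam eps"
  proof (cases "c \<le> d")
    case True
    note sub = is_interval_Icc_subset[OF int cd(1,3)]
    have "\<exists>u\<in>{c..d}. dist (q t) (h u) \<le> close_gauge N l0 e0 l1 e1 R lam eps"
      by (rule close[OF quasi_geodesic_on_subset[OF h sub] True]) (use cd c in \<open>auto simp: is_interval_cc\<close>)
    then show ?thesis using sub by blast
  next
    case False
    note sub = is_interval_Icc_subset[OF int cd(3,1)]
    have "quasi_geodesic_on l1 e1 {d..c} h"
      by (rule quasi_geodesic_on_subset[OF h sub]) (simp add: is_interval_cc)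
    then have "\<exists>u\<in>{-c..-d}. dist (q t) (h (- u)) \<le> close_gauge N l0 e0 l1 e1 R lam eps"
      by (intro close quasi_geodesic_on_reverse) (use cd c False in auto)
    then obtain u where "u \<in> {-c..-d}" "dist (q t) (h (- u)) \<le> close_gauge N l0 e0 l1 e1 R lam eps"
      by blast
    then show ?thesis using sub by (intro bexI[of _ "- u"]) auto
  qed
qed

subsection \<open>Triangles with Morse sides\<close>

text \<open>Without continuity of \<open>q\<close> the infimum need not be attained, hence the slack
  \<open>e\<close>.\<close>

lemma exists_near_closest:
  fixes q :: "real \<Rightarrow> 'a::metric_space"
  assumes "J \<noteq> {}" "e > 0"
  shows "\<exists>t0\<in>J. \<forall>t\<in>J. dist (q t0) z \<le> dist (q t) z + e"
proof -
  let ?D = "(\<lambda>t. dist (q t) z) ` J"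
  have bdd: "bdd_below ?D" by (rule bdd_belowI[of _ 0]) auto
  have "Inf ?D < Inf ?D + e" using assms by simp
  then obtain d where d: "d \<in> ?D" "d < Inf ?D + e" using cInf_lessD[of ?D] assms by blast
  then obtain t0 where t0: "t0 \<in> J" "dist (q t0) z < Inf ?D + e" by blast
  have "dist (q t0) z \<le> dist (q t) z + e" if "t \<in> J" for t
    using t0(2) cInf_lower[OF imageI[OF that] bdd] by linarith
  then show ?thesis using t0 by blast
qed

text \<open>A point \<open>w\<close> at distance \<open>r\<close> from \<open>q t0\<close> on the added geodesic and a point \<open>q s\<close> satisfy
  both \<open>dist (q s) w \<ge> r - 1\<close>, because \<open>t0\<close> is almost closest to \<open>z\<close>, and
  \<open>dist (q s) w \<ge> dist (q s) (q t0) - r\<close>; a convex combination of the two gives the lower bound.\<close>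

lemma quasi_geodesic_append_closest:
  fixes q :: "real \<Rightarrow> 'a::metric_space"
  assumes geo: "geodesic_space TYPE('a)"
    and q: "quasi_geodesic_on lam eps {a..b} q" "lam \<ge> 1" "eps \<ge> 0"
    and t0: "t0 \<in> {a..b}" "\<And>t. t \<in> {a..t0} \<Longrightarrow> dist (q t0) z \<le> dist (q t) z + 1"
  obtains p where "quasi_geodesic_on (3 * lam) (eps + 2) {a..t0 + dist (q t0) z} p"
    "\<And>t. t \<le> t0 \<Longrightarrow> p t = q t" "p (t0 + dist (q t0) z) = z"
proof -
  obtain \<gamma> where \<gamma>: "geodesic_from (q t0) z \<gamma>" using geo by (auto simp: geodesic_space_def)
  define r where "r = dist (q t0) z"
  have r0: "r \<ge> 0" by (simp add: r_def)
  have \<gamma>0: "\<gamma> 0 = q t0" and \<gamma>r: "\<gamma> r = z"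
    and \<gamma>d: "\<And>s t. s \<in> {0..r} \<Longrightarrow> t \<in> {0..r} \<Longrightarrow> dist (\<gamma> s) (\<gamma> t) = \<bar>s - t\<bar>"
    using \<gamma> by (auto simp: geodesic_from_def r_def)
  define p where "p t = (if t \<le> t0 then q t else \<gamma> (t - t0))" for t
  let ?B = "\<lambda>s t. \<bar>s - t\<bar> / (3 * lam) - (eps + 2) \<le> dist (p s) (p t) \<and>
     dist (p s) (p t) \<le> 3 * lam * \<bar>s - t\<bar> + (eps + 2)"
  have div_le: "x / (3 * lam) \<le> x / lam" "x / (3 * lam) \<le> x / 3" if "x \<ge> 0" for x
    using that q(2) by (intro divide_left_mono; simp)+
  have le_mul: "x \<le> 3 * lam * x" "lam * x \<le> 3 * lam * x" if "x \<ge> 0" for x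
  proof -
    show "lam * x \<le> 3 * lam * x" using that q(2) by (intro mult_right_mono) auto
    show "x \<le> 3 * lam * x" using that q(2) mult_right_mono[of 1 "3 * lam" x] by auto
  qed
  have B: "?B s t" if "a \<le> s" "s \<le> t" "t \<le> t0 + r" for s t
  proof -
    consider "t \<le> t0" | "t0 < s" | "s \<le> t0" "t0 < t" by linarith
    then show ?thesis
    proof cases
      case 1
      then have "s \<in> {a..b}" "t \<in> {a..b}" using that t0 by auto
      from quasi_geodesic_onD[OF q(1) this] show ?thesis
        using 1 that div_le(1)[of "\<bar>s - t\<bar>"] le_mul(2)[of "\<bar>s - t\<bar>"] by (simp add: p_def)
    next
      case 2
      then have "dist (p s) (p t) = \<bar>s - t\<bar>" using that \<gamma>d[of "s - t0" "t - t0"] by (simp add: p_def)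
      moreover have "\<bar>s - t\<bar> / (3 * lam) \<le> \<bar>s - t\<bar>" by (rule order_trans[OF div_le(2)[OF abs_ge_zero]]) simp
      ultimately show ?thesis using q le_mul(1)[of "\<bar>s - t\<bar>"] by linarith
    next
      case 3
      let ?w = "\<gamma> (t - t0)"
      have m: "s \<in> {a..b}" "t0 \<in> {a..b}" using 3 that t0 by auto
      have d1: "dist (q t0) ?w = t - t0" using \<gamma>d[of 0 "t - t0"] \<gamma>0 3 that by simp
      have d2: "dist ?w z = r - (t - t0)" using \<gamma>d[of "t - t0" r] \<gamma>r 3 that by simp
      have d3: "r \<le> dist (q s) z + 1" using t0(2)[of s] 3 that by (simp add: r_def)
      have X1: "(t - t0) - 1 \<le> dist (q s) ?w" using d2 d3 dist_triangle[of "q s" z ?w] by linarith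
      have qs: "(t0 - s) / lam - eps \<le> dist (q s) (q t0)" "dist (q s) (q t0) \<le> lam * (t0 - s) + eps"
        using quasi_geodesic_onD[OF q(1) m] 3 by auto
      have X2: "(t0 - s) / lam - eps - (t - t0) \<le> dist (q s) ?w"
        using qs(1) d1 dist_triangle2[of "q s" "q t0" ?w] by linarith
      have X3: "dist (q s) ?w \<le> lam * (t0 - s) + eps + (t - t0)"
        using qs(2) d1 dist_triangle[of "q s" ?w "q t0"] by linarith
      define U V where "U = (t0 - s) / lam" and "V = (t - t0) / (3 * lam)"
      have UV: "\<bar>s - t\<bar> / (3 * lam) = U / 3 + V"
        using 3 by (simp add: U_def V_def add_divide_distrib[symmetric] mult.commute)
      have "V \<le> (t - t0) / 3" using div_le(2)[of "t - t0"] 3 by (simp add: V_def)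
      moreover have "U - eps - (t - t0) \<le> dist (q s) ?w" using X2 by (simp add: U_def)
      \<comment> \<open>Weights 2/3 on \<open>X1\<close> and 1/3 on \<open>X2\<close> leave
        \<open>U / 3 + (t - t0) / 3\<close> up to a constant; this is where the factor 3 in
        \<open>3 * lam\<close> comes from.\<close>
      ultimately have "\<bar>s - t\<bar> / (3 * lam) - (eps + 2) \<le> dist (q s) ?w"
        using X1 q(3) unfolding UV by argo
      moreover have "3 * lam * \<bar>s - t\<bar> = 3 * lam * (t0 - s) + 3 * lam * (t - t0)"
        using 3 by (simp add: algebra_simps)
      moreover have "lam * (t0 - s) \<le> 3 * lam * (t0 - s)" "t - t0 \<le> 3 * lam * (t - t0)"
        by (rule le_mul; use 3 in simp)+
      moreover from calculation have "dist (q s) ?w \<le> 3 * lam * \<bar>s - t\<bar> + (eps + 2)"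
        using X3 by argo
      ultimately show ?thesis using 3 by (simp add: p_def)
    qed
  qed
  have "quasi_geodesic_on (3 * lam) (eps + 2) {a..t0 + r} p"
    unfolding quasi_geodesic_on_def
  proof (intro conjI[OF is_interval_cc] ballI)
    fix s t assume "s \<in> {a..t0 + r}" "t \<in> {a..t0 + r}"
    then show "?B s t" using B[of s t] B[of t s] by (cases "s \<le> t") (auto simp: dist_commute abs_minus_commute)
  qed
  moreover have "p t = q t" if "t \<le> t0" for t using that by (simp add: p_def)
  moreover have "p (t0 + r) = z" using r0 \<gamma>0 \<gamma>r by (auto simp: p_def)
  ultimately show thesis using that unfolding r_def by blast
qed

text \<open>Up to \<open>t0\<close>, the path \<open>q\<close> followed by a geodesic to
  \<open>z\<close> is a quasi-geodesic with both ends near \<open>f\<close>, so the Morse property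
  applies to it although \<open>q b\<close> may be far from \<open>f\<close>.\<close>

lemma morse_near_until_closest:
  fixes q :: "real \<Rightarrow> 'a::metric_space"
  assumes geo: "geodesic_space TYPE('a)"
    and N: "morse_gauge N" "N_morse_on N I f"
    and q: "quasi_geodesic_on lam eps {a..b} q" "lam \<ge> 1" "eps \<ge> 0" "R \<ge> 0"
    and t0: "t0 \<in> {a..b}" "\<And>t. t \<in> {a..b} \<Longrightarrow> dist (q t0) z \<le> dist (q t) z + 1"
    and near: "\<exists>s\<in>I. dist (q a) (f s) \<le> R" "\<exists>s\<in>I. dist z (f s) \<le> R" and t: "t \<in> {a..t0}"
  shows "\<exists>s\<in>I. dist (q t) (f s) \<le> N (3 * lam) (eps + 2 + 2 * R) + R"
proof -
  have "dist (q t0) z \<le> dist (q t) z + 1" if "t \<in> {a..t0}" for t using that t0 by auto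
  then obtain p where p: "quasi_geodesic_on (3 * lam) (eps + 2) {a..t0 + dist (q t0) z} p"
    "\<And>t. t \<le> t0 \<Longrightarrow> p t = q t" "p (t0 + dist (q t0) z) = z"
    using quasi_geodesic_append_closest[OF geo q(1-3) t0(1)] by blast
  have "p a = q a" "p t = q t" "t \<in> {a..t0 + dist (q t0) z}"
    using p(2) t t0(1) by (auto intro: add_increasing2)
  then show ?thesis using N_morse_on_near_endpoints[OF N(2,1) p(1) _ _ q(4), of t] p(3) near q by auto
qed

text \<open>A thin triangle with vertices \<open>q a\<close>, \<open>q b\<close> and
  \<open>z\<close>: after a cut at an almost closest point to \<open>z\<close>, both halves can be
  closed up by a geodesic to \<open>z\<close>, the second one after reversal.\<close>

lemma morse_tripod:
  fixes q :: "real \<Rightarrow> 'a::metric_space"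
  assumes geo: "geodesic_space TYPE('a)"
    and N: "morse_gauge N" "N_morse_on N I f" "N_morse_on N J h"
    and q: "quasi_geodesic_on lam eps {a..b} q" "lam \<ge> 1" "eps \<ge> 0" "R \<ge> 0" "a \<le> b"
    and near: "\<exists>s\<in>I. dist (q a) (f s) \<le> R" "\<exists>s\<in>I. dist z (f s) \<le> R"
      "\<exists>s\<in>J. dist (q b) (h s) \<le> R" "\<exists>s\<in>J. dist z (h s) \<le> R"
  obtains t0 where "t0 \<in> {a..b}"
    "\<And>t. t \<in> {a..t0} \<Longrightarrow> \<exists>s\<in>I. dist (q t) (f s) \<le> N (3 * lam) (eps + 2 + 2 * R) + R"
    "\<And>t. t \<in> {t0..b} \<Longrightarrow> \<exists>s\<in>J. dist (q t) (h s) \<le> N (3 * lam) (eps + 2 + 2 * R) + R"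
proof -
  obtain t0 where t0: "t0 \<in> {a..b}" "\<And>t. t \<in> {a..b} \<Longrightarrow> dist (q t0) z \<le> dist (q t) z + 1"
    using exists_near_closest[of "{a..b}" 1 q z] q(5) by auto
  show thesis
  proof (rule that[OF t0(1)])
    show "\<exists>s\<in>I. dist (q t) (f s) \<le> N (3 * lam) (eps + 2 + 2 * R) + R" if "t \<in> {a..t0}" for t
      by (rule morse_near_until_closest[OF geo N(1,2) q(1-4) t0 near(1,2) that])
    show "\<exists>s\<in>J. dist (q t) (h s) \<le> N (3 * lam) (eps + 2 + 2 * R) + R" if "t \<in> {t0..b}" for t
    proof -
      have "\<exists>s\<in>J. dist (q (- (- t))) (h s) \<le> N (3 * lam) (eps + 2 + 2 * R) + R"
        by (rule morse_near_until_closest[OF geo N(1,3) quasi_geodesic_on_reverse[OF q(1)] q(2-4), of "-t0" z])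
          (use t0 near that in auto)
      then show ?thesis by simp
    qed
  qed
qed

text \<open>Only a quasi-geodesic joining different pieces needs an argument: it is a side of a
  tripod with \<open>z = f v\<close> and \<open>R = 0\<close>. Hence the summand at
  \<open>(3 * lam, eps + 2)\<close>.\<close>

lemma morse_on_join:
  fixes f :: "real \<Rightarrow> 'a::metric_space"
  assumes geo: "geodesic_space TYPE('a)" and N: "morse_gauge N"
    and f: "N_morse_on N {a..v} f" "N_morse_on N {v..b} f" and v: "v \<in> {a..b}"
  shows "N_morse_on (\<lambda>lam eps. N lam eps + N (3 * lam) (eps + 2)) {a..b} f"
  unfolding N_morse_on_def
proof (intro allI impI ballI)
  fix lam eps :: real and c d q t assume le: "lam \<ge> 1" "eps \<ge> 0"
    and q: "c \<le> d" "quasi_geodesic_on lam eps {c..d} q"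
    and e: "q c \<in> f ` {a..b}" "q d \<in> f ` {a..b}" and t: "t \<in> {c..d}"
  have N0: "N lam eps \<ge> 0" "N (3 * lam) (eps + 2) \<ge> 0" using N le by (auto simp: morse_gauge_def)
  have cov: "{a..b} = {a..v} \<union> {v..b}" using v by auto
  have zn: "\<exists>s\<in>J. dist (f v) (f s) \<le> 0" if "v \<in> J" for J using that by auto
  have v': "v \<in> {a..v}" "v \<in> {v..b}" using v by auto
  have im: "\<exists>s\<in>J. dist x (f s) \<le> 0" if "x \<in> f ` J" for J x using that by auto
  have same: "\<exists>s\<in>J. dist (q t) (f s) \<le> N lam eps"
    if "N_morse_on N J f" "q c \<in> f ` J" "q d \<in> f ` J" for J
    using that le q t unfolding N_morse_on_def by blast
  have mixed: "\<exists>s\<in>J \<union> K. dist (q t) (f s) \<le> N (3 * lam) (eps + 2)"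
    if J: "N_morse_on N J f" "N_morse_on N K f" "q c \<in> f ` J" "q d \<in> f ` K" "v \<in> J" "v \<in> K" for J K
  proof -
    obtain t0 where "t0 \<in> {c..d}"
      "\<And>t. t \<in> {c..t0} \<Longrightarrow> \<exists>s\<in>J. dist (q t) (f s) \<le> N (3 * lam) (eps + 2 + 2 * 0) + 0"
      "\<And>t. t \<in> {t0..d} \<Longrightarrow> \<exists>s\<in>K. dist (q t) (f s) \<le> N (3 * lam) (eps + 2 + 2 * 0) + 0"
      using morse_tripod[OF geo N J(1,2) q(2) le _ q(1) im[OF J(3)] zn[OF J(5)] im[OF J(4)] zn[OF J(6)]]
      by (metis order_refl)
    moreover have "t \<in> {c..t0} \<or> t \<in> {t0..d}" using t by auto
    ultimately show ?thesis by (metis UnCI add.right_neutral mult_zero_right)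
  qed
  have "(\<exists>s\<in>{a..b}. dist (q t) (f s) \<le> N lam eps) \<or> (\<exists>s\<in>{a..b}. dist (q t) (f s) \<le> N (3 * lam) (eps + 2))"
  proof -
    consider "q c \<in> f ` {a..v}" "q d \<in> f ` {a..v}" | "q c \<in> f ` {v..b}" "q d \<in> f ` {v..b}"
      | "q c \<in> f ` {a..v}" "q d \<in> f ` {v..b}" | "q c \<in> f ` {v..b}" "q d \<in> f ` {a..v}"
      using e unfolding cov by blast
    then show ?thesis
    proof cases
      case 1 then show ?thesis using same[OF f(1)] cov by blast
    next
      case 2 then show ?thesis using same[OF f(2)] cov by blast
    next
      case 3 show ?thesis using mixed[OF f 3 v'] cov by simp
    next
      case 4 show ?thesis using mixed[OF f(2,1) 4 v'(2,1)] cov by (simp add: Un_commute)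
    qed
  qed
  then show "\<exists>s\<in>{a..b}. dist (q t) (f s) \<le> N lam eps + N (3 * lam) (eps + 2)"
    using N0 by force
qed

text \<open>The initial segment from \<open>\<alpha> 0\<close> to a closest point of \<open>\<beta>\<close>, a long piece of \<open>\<beta>\<close>, and a final
  segment from a point of \<open>\<beta>\<close> closest to a far point of \<open>\<alpha>\<close> form a quasi-geodesic with uniform
  constants: the finite Hausdorff distance only affects how far out on \<open>\<beta>\<close> one has to go.\<close>

lemma asymptotic_rays_uniformly_close:
  fixes \<alpha> \<beta> :: "real \<Rightarrow> 'a::metric_space"
  assumes geo: "geodesic_space TYPE('a)" and \<beta>: "geodesic_ray \<beta>"
    and N: "N_morse_on N {0..} \<alpha>" and D: "\<And>t. t \<ge> 0 \<Longrightarrow> \<exists>s\<ge>0. dist (\<beta> t) (\<alpha> s) \<le> D"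
  obtains t0 where "t0 \<ge> 0" "\<And>t. t \<ge> t0 \<Longrightarrow> \<exists>s\<ge>0. dist (\<beta> t) (\<alpha> s) \<le> N 9 4"
proof -
  obtain t0 where t0: "t0 \<ge> 0" "\<And>t. t \<ge> 0 \<Longrightarrow> dist (\<beta> t0) (\<alpha> 0) \<le> dist (\<beta> t) (\<alpha> 0) + 1"
    using exists_near_closest[of "{0..}" 1 \<beta> "\<alpha> 0"] by auto
  have "\<exists>s\<ge>0. dist (\<beta> t) (\<alpha> s) \<le> N 9 4" if t: "t \<ge> t0" for t
  proof -
    obtain s' where "s' \<ge> 0" "dist (\<beta> 0) (\<alpha> s') \<le> D" using D[of 0] by auto
    then have D0: "D \<ge> 0" using zero_le_dist[of "\<beta> 0" "\<alpha> s'"] by linarith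
    \<comment> \<open>A point of \<open>p'\<close> within \<open>2 * D + 1\<close> of
      \<open>p' T\<close> has parameter within \<open>3 * (2 * D + 1 + 2) = 6 * D + 9\<close> of
      \<open>T\<close>, as \<open>p'\<close> is a \<open>(3, 2)\<close>-quasi-geodesic; so the cut
      at \<open>t3\<close> comes no earlier than \<open>t\<close>.\<close>
    define T where "T = t + 6 * D + 9"
    have T: "t \<le> T" "t0 \<le> T" "0 \<le> T" using t t0 D0 by (auto simp: T_def)
    \<comment> \<open>Geodesics are only appended on the right, so \<beta> is reversed in order to
      attach \<open>\<alpha> 0\<close> on the left.\<close>
    have "quasi_geodesic_on 1 0 {t0..T} \<beta>"
      by (rule quasi_geodesic_on_subset[OF geodesic_ray_quasi_geodesic[OF \<beta>]])
        (use t0 in \<open>auto simp: is_interval_cc\<close>)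
    then have rq: "quasi_geodesic_on 1 0 {-T..-t0} (\<lambda>u. \<beta> (- u))"
      by (rule quasi_geodesic_on_reverse)
    let ?r = "dist (\<beta> t0) (\<alpha> 0)"
    obtain p where p: "quasi_geodesic_on 3 2 {-T..-t0 + ?r} p"
      "\<And>u. u \<le> -t0 \<Longrightarrow> p u = \<beta> (-u)" "p (-t0 + ?r) = \<alpha> 0"
      by (rule quasi_geodesic_append_closest[OF geo rq, of "-t0" "\<alpha> 0"]) (use t0 T in auto)
    define p' where "p' u = p (- u)" for u
    have p': "quasi_geodesic_on 3 2 {t0 - ?r..T} p'" "\<And>u. u \<ge> t0 \<Longrightarrow> p' u = \<beta> u" "p' (t0 - ?r) = \<alpha> 0"
      using quasi_geodesic_on_reverse[OF p(1)] p(2,3) by (auto simp: p'_def[abs_def])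
    obtain s' where s': "s' \<ge> 0" "dist (\<beta> T) (\<alpha> s') \<le> D" using D[of T] T by blast
    have ne: "{t0 - ?r..T} \<noteq> {}" "T \<in> {t0 - ?r..T}"
      using T(2) zero_le_dist[of "\<beta> t0" "\<alpha> 0"] unfolding atLeastatMost_empty_iff atLeastAtMost_iff
      by linarith+
    obtain t3 where t3: "t3 \<in> {t0 - ?r..T}"
      "\<And>u. u \<in> {t0 - ?r..T} \<Longrightarrow> dist (p' t3) (\<alpha> s') \<le> dist (p' u) (\<alpha> s') + 1"
      using exists_near_closest[OF ne(1), of 1 p' "\<alpha> s'"] by auto
    have "dist (p' t3) (p' T) \<le> 2 * D + 1"
      using t3(2)[OF ne(2)] s'(2) p'(2)[OF T(2)] dist_triangle2[of "p' t3" "p' T" "\<alpha> s'"] by simp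
    then have "t \<le> t3"
      using quasi_geodesic_on_param_dist[OF p'(1) t3(1) ne(2)] by (simp add: T_def)
    obtain w where w: "quasi_geodesic_on 9 4 {t0 - ?r..t3 + dist (p' t3) (\<alpha> s')} w"
      "\<And>u. u \<le> t3 \<Longrightarrow> w u = p' u" "w (t3 + dist (p' t3) (\<alpha> s')) = \<alpha> s'"
      by (rule quasi_geodesic_append_closest[OF geo p'(1), of t3 "\<alpha> s'"]) (use t3 in auto)
    let ?b = "t3 + dist (p' t3) (\<alpha> s')"
    have "w (t0 - ?r) = \<alpha> 0" using w(2) t3(1) p'(3) by simp
    then have "w (t0 - ?r) \<in> \<alpha> ` {0..}" "w ?b \<in> \<alpha> ` {0..}" using w(3) s' by auto
    moreover have "t \<in> {t0 - ?r..?b}" using t \<open>t \<le> t3\<close> zero_le_dist[of "\<beta> t0" "\<alpha> 0"] zero_le_dist[of "p' t3" "\<alpha> s'"]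
      unfolding atLeastAtMost_iff by linarith
    moreover have "t0 - ?r \<le> ?b" using calculation(3) by simp
    ultimately have "\<exists>s\<in>{0..}. dist (w t) (\<alpha> s) \<le> N 9 4"
      using N w(1) unfolding N_morse_on_def by (meson one_le_numeral zero_le_numeral)
    moreover have "w t = \<beta> t" using w(2) p'(2) t \<open>t \<le> t3\<close> by simp
    ultimately show ?thesis by auto
  qed
  then show thesis using that t0(1) by blast
qed

text \<open>Relative to the pair \<open>t0\<close>, \<open>s0\<close>, the distances
  \<open>t - t0\<close> and \<open>\<bar>s - s0\<bar>\<close> differ by at most
  \<open>2 * N 9 4\<close>, so the parameter on \<alpha> is \<open>t + (s0 - t0)\<close> up to that
  error.\<close>

lemma asymptotic_rays_shift:
  fixes \<alpha> \<beta> :: "real \<Rightarrow> 'a::metric_space"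
  assumes geo: "geodesic_space TYPE('a)" and \<beta>: "geodesic_ray \<beta>" and \<alpha>: "geodesic_ray \<alpha>"
    and N: "N_morse_on N {0..} \<alpha>" and D: "\<And>t. t \<ge> 0 \<Longrightarrow> \<exists>s\<ge>0. dist (\<beta> t) (\<alpha> s) \<le> D"
  shows "\<exists>c T. \<forall>t\<ge>T. t \<ge> 0 \<and> t + c \<ge> 0 \<and> dist (\<beta> t) (\<alpha> (t + c)) \<le> 3 * N 9 4"
proof -
  obtain t0 where t0: "t0 \<ge> 0" "\<And>t. t \<ge> t0 \<Longrightarrow> \<exists>s\<ge>0. dist (\<beta> t) (\<alpha> s) \<le> N 9 4"
    using asymptotic_rays_uniformly_close[OF geo \<beta> N D] by blast
  obtain s0 where s0: "s0 \<ge> 0" "dist (\<beta> t0) (\<alpha> s0) \<le> N 9 4" using t0 by blast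
  have N0: "N 9 4 \<ge> 0" using s0(2) zero_le_dist[of "\<beta> t0" "\<alpha> s0"] by linarith
  have "t \<ge> 0 \<and> t + (s0 - t0) \<ge> 0 \<and> dist (\<beta> t) (\<alpha> (t + (s0 - t0))) \<le> 3 * N 9 4"
    if t: "t \<ge> t0 + s0 + 2 * N 9 4 + 1" for t
  proof -
    have tt: "t \<ge> t0" "t \<ge> 0" using t t0 s0 N0 by linarith+
    obtain s where s: "s \<ge> 0" "dist (\<beta> t) (\<alpha> s) \<le> N 9 4" using t0(2)[OF tt(1)] by blast
    have db: "dist (\<beta> t) (\<beta> t0) = t - t0" using \<beta> tt t0 by (auto simp: geodesic_ray_def)
    have da: "dist (\<alpha> s) (\<alpha> s0) = \<bar>s - s0\<bar>" using \<alpha> s s0 by (auto simp: geodesic_ray_def)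
    have "\<bar>(t - t0) - \<bar>s - s0\<bar>\<bar> \<le> 2 * N 9 4"
      using s(2) s0(2) dist_triangle[of "\<beta> t" "\<beta> t0" "\<alpha> s"] dist_triangle[of "\<alpha> s" "\<beta> t0" "\<alpha> s0"]
        dist_triangle[of "\<alpha> s" "\<alpha> s0" "\<beta> t"] dist_triangle[of "\<beta> t" "\<alpha> s0" "\<beta> t0"]
        dist_commute[of "\<alpha> s" "\<beta> t"] dist_commute[of "\<alpha> s0" "\<beta> t0"] unfolding db da by linarith
    \<comment> \<open>The size of \<open>t\<close> rules out \<open>s < s0\<close>, which fixes the
      sign inside the absolute value.\<close>
    then have ss: "\<bar>s - (t + (s0 - t0))\<bar> \<le> 2 * N 9 4" using t s(1) s0 by linarith
    have ge: "t + (s0 - t0) \<ge> 0" using tt s0 by simp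
    have "dist (\<alpha> s) (\<alpha> (t + (s0 - t0))) = \<bar>s - (t + (s0 - t0))\<bar>"
      using \<alpha> s ge by (auto simp: geodesic_ray_def)
    then have "dist (\<beta> t) (\<alpha> (t + (s0 - t0))) \<le> 3 * N 9 4"
      using ss s(2) dist_triangle[of "\<beta> t" "\<alpha> (t + (s0 - t0))" "\<alpha> s"] by linarith
    then show ?thesis using tt ge by blast
  qed
  then show ?thesis by blast
qed

text \<open>\<open>S\<close> is the slack at the vertices, with \<open>3 * N 9 4\<close> for the cut
  near the ideal vertex. \<open>M\<close> serves each of the two parts of the side, and the sum
  comes from joining them.\<close>

definition ideal_triangle_gauge :: "(real \<Rightarrow> real \<Rightarrow> real) \<Rightarrow> real \<Rightarrow> real \<Rightarrow> real \<Rightarrow> real" where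
  "ideal_triangle_gauge N R =
    (let S = R + 3 * N 9 4; M = close_gauge N 1 0 1 0 (N 3 (2 + 2 * S) + S)
     in (\<lambda>lam eps. M lam eps + M (3 * lam) (eps + 2)))"

text \<open>The ideal vertex is replaced by \<open>\<beta> T\<close>, which lies within
  \<open>3 * N 9 4\<close> of \<alpha>. The tripod splits \<gamma> into a part near \<alpha> and a
  part near \<beta>, each Morse by comparison with its ray. The gauge depends on \<open>N\<close>
  and \<open>R\<close> alone, which makes it uniform over translates.\<close>

lemma ideal_triangle_side_morse:
  fixes \<alpha> \<beta> \<gamma> :: "real \<Rightarrow> 'a::metric_space"
  assumes geo: "geodesic_space TYPE('a)" and N: "morse_gauge N" and "R \<ge> 0"
    and \<alpha>: "geodesic_ray \<alpha>" "N_morse_on N {0..} \<alpha>" and \<beta>: "geodesic_ray \<beta>" "N_morse_on N {0..} \<beta>"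
    and D: "\<And>t. t \<ge> 0 \<Longrightarrow> \<exists>s\<ge>0. dist (\<beta> t) (\<alpha> s) \<le> D"
    and \<gamma>: "geodesic_from x y \<gamma>"
    and xy: "\<exists>s\<ge>0. dist x (\<alpha> s) \<le> R" "\<exists>s\<ge>0. dist y (\<beta> s) \<le> R"
  shows "morse_gauge (ideal_triangle_gauge N R)" "N_morse_on (ideal_triangle_gauge N R) {0..dist x y} \<gamma>"
proof -
  define S where "S = R + 3 * N 9 4"
  define B where "B = N 3 (2 + 2 * S) + S"
  define M where "M = close_gauge N 1 0 1 0 B"
  have gauge: "ideal_triangle_gauge N R = (\<lambda>lam eps. M lam eps + M (3 * lam) (eps + 2))"
    by (simp add: ideal_triangle_gauge_def Let_def S_def B_def M_def)
  have N0: "N 9 4 \<ge> 0" using N by (simp add: morse_gauge_def)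
  then have S0: "S \<ge> R" "S \<ge> 0" using assms by (auto simp: S_def)
  then have "N 3 (2 + 2 * S) \<ge> 0" using N by (simp add: morse_gauge_def)
  then have B0: "B \<ge> 0" using S0 by (simp add: B_def)
  have M: "morse_gauge M" unfolding M_def by (rule morse_gauge_close_gauge) (use N B0 in auto)
  then show "morse_gauge (ideal_triangle_gauge N R)"
    unfolding gauge by (auto simp: morse_gauge_def)
  obtain c T where "\<forall>t\<ge>T. t \<ge> 0 \<and> t + c \<ge> 0 \<and> dist (\<beta> t) (\<alpha> (t + c)) \<le> 3 * N 9 4"
    using asymptotic_rays_shift[OF geo \<beta>(1) \<alpha> D] by blast
  then have z: "T \<ge> 0" "T + c \<ge> 0" "dist (\<beta> T) (\<alpha> (T + c)) \<le> 3 * N 9 4" by auto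
  let ?l = "dist x y"
  have \<gamma>q: "quasi_geodesic_on 1 0 {0..?l} \<gamma>" by (rule geodesic_from_quasi_geodesic[OF \<gamma>])
  have ends: "\<gamma> 0 = x" "\<gamma> ?l = y" using \<gamma> by (auto simp: geodesic_from_def)
  obtain v where v: "v \<in> {0..?l}"
    "\<And>t. t \<in> {0..v} \<Longrightarrow> \<exists>s\<in>{0..}. dist (\<gamma> t) (\<alpha> s) \<le> N (3 * 1) (0 + 2 + 2 * S) + S"
    "\<And>t. t \<in> {v..?l} \<Longrightarrow> \<exists>s\<in>{0..}. dist (\<gamma> t) (\<beta> s) \<le> N (3 * 1) (0 + 2 + 2 * S) + S"
  proof (rule morse_tripod[OF geo N \<alpha>(2) \<beta>(2) \<gamma>q _ _ S0(2)])
    show "\<exists>s\<in>{0..}. dist (\<gamma> 0) (\<alpha> s) \<le> S" "\<exists>s\<in>{0..}. dist (\<gamma> ?l) (\<beta> s) \<le> S"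
      using xy S0 unfolding ends by force+
    show "\<exists>s\<in>{0..}. dist (\<beta> T) (\<alpha> s) \<le> S"
      using z(2,3) \<open>R \<ge> 0\<close> by (intro bexI[of _ "T + c"]) (auto simp: S_def)
    show "\<exists>s\<in>{0..}. dist (\<beta> T) (\<beta> s) \<le> S" using z S0 by (intro bexI[of _ T]) auto
  qed auto
  have sub: "quasi_geodesic_on 1 0 {u..w} \<gamma>" if "0 \<le> u" "w \<le> ?l" for u w
    by (rule quasi_geodesic_on_subset[OF \<gamma>q]) (use that in \<open>auto simp: is_interval_cc\<close>)
  have morse: "N_morse_on M {u..w} \<gamma>"
    if "0 \<le> u" "w \<le> ?l" "geodesic_ray \<zeta>" "N_morse_on N {0..} \<zeta>"
      and near: "\<And>t. t \<in> {u..w} \<Longrightarrow> \<exists>s\<in>{0..}. dist (\<gamma> t) (\<zeta> s) \<le> B" for u w \<zeta>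
    unfolding M_def
  proof (rule morse_of_pairwise_near_morse[OF N _ _ _ _ B0 sub[OF that(1,2)]])
    show "\<exists>J f. quasi_geodesic_on 1 0 J f \<and> N_morse_on N J f \<and>
        (\<exists>s\<in>J. dist (\<gamma> c) (f s) \<le> B) \<and> (\<exists>s\<in>J. dist (\<gamma> d) (f s) \<le> B)"
      if "c \<in> {u..w}" "d \<in> {u..w}" for c d
      using geodesic_ray_quasi_geodesic[OF \<open>geodesic_ray \<zeta>\<close>] \<open>N_morse_on N {0..} \<zeta>\<close> near that by blast
  qed auto
  have "N_morse_on M {0..v} \<gamma>" by (rule morse[OF _ _ \<alpha>]) (use v in \<open>auto simp: B_def\<close>)
  moreover have "N_morse_on M {v..?l} \<gamma>" by (rule morse[OF _ _ \<beta>]) (use v in \<open>auto simp: B_def\<close>)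
  ultimately show "N_morse_on (ideal_triangle_gauge N R) {0..?l} \<gamma>"
    unfolding gauge by (rule morse_on_join[OF geo M _ _ v(1)])
qed

subsection \<open>Limits of geodesics and the Morse boundary\<close>

lemma N_morse_on_isometry:
  fixes h :: "'a::metric_space \<Rightarrow> 'a"
  assumes h: "\<And>x y. dist (h x) (h y) = dist x y" "\<And>x. h (k x) = x" and f: "N_morse_on N I f"
  shows "N_morse_on N I (h \<circ> f)"
  unfolding N_morse_on_def
proof (intro allI impI ballI)
  fix lam eps :: real and a b q t assume le: "lam \<ge> 1" "eps \<ge> 0" "a \<le> b"
    and q: "quasi_geodesic_on lam eps {a..b} q"
    and e: "q a \<in> (h \<circ> f) ` I" "q b \<in> (h \<circ> f) ` I" and t: "t \<in> {a..b}"
  have kd: "dist (k x) (k y) = dist x y" for x y using h(1)[of "k x" "k y"] h(2) by simp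
  have kh: "k (h x) = x" for x using h(1)[of "k (h x)" x] h(2) by simp
  have "quasi_geodesic_on lam eps {a..b} (k \<circ> q)" using q by (simp add: quasi_geodesic_on_def kd)
  moreover have "(k \<circ> q) a \<in> f ` I" "(k \<circ> q) b \<in> f ` I" using e kh by auto
  ultimately obtain s where "s \<in> I" "dist ((k \<circ> q) t) (f s) \<le> N lam eps"
    using f le t unfolding N_morse_on_def by metis
  moreover have "dist (k (q t)) (f s) = dist (q t) (h (f s))"
    using h(1)[of "k (q t)" "f s"] h(2) by simp
  ultimately show "\<exists>s\<in>I. dist (q t) ((h \<circ> f) s) \<le> N lam eps" by force
qed

text \<open>Tychonoff takes the place of Arzela-Ascoli: the geodesics, extended by the constant
  value \<open>x\<close>, lie in the compact product of the balls
  \<open>cball x \<bar>t\<bar>\<close> and have a cluster point \<alpha>. In this uncountable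
  product it need not be the limit of a subsequence, so closeness is asserted at two times at once
  for arbitrarily late \<open>n\<close>; two suffice for distances and for the pairwise Morse
  criterion.\<close>

lemma geodesic_limit_ray:
  fixes \<gamma> :: "nat \<Rightarrow> real \<Rightarrow> 'a::metric_space"
  assumes proper: "proper_space TYPE('a)" and \<gamma>: "\<And>n. geodesic_from x (y n) (\<gamma> n)"
    and inf: "filterlim (\<lambda>n. dist x (y n)) at_top sequentially"
  obtains \<alpha> where "geodesic_ray \<alpha>" "\<alpha> 0 = x"
    "\<And>s t m. s \<ge> 0 \<Longrightarrow> t \<ge> 0 \<Longrightarrow> \<exists>n\<ge>m. s \<le> dist x (y n) \<and> t \<le> dist x (y n) \<and>
       dist (\<gamma> n s) (\<alpha> s) < 1 \<and> dist (\<gamma> n t) (\<alpha> t) < 1"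
proof -
  define f where "f n t = (if 0 \<le> t \<and> t \<le> dist x (y n) then \<gamma> n t else x)" for n t
  let ?S = "\<Pi>\<^sub>E t\<in>UNIV. cball x \<bar>t\<bar>"
  have "compactin (product_topology (\<lambda>i. euclidean) UNIV) ?S"
    using proper by (auto simp: compactin_PiE proper_space_def)
  then have comp: "compact ?S" by (simp add: euclidean_product_topology)
  have "f n \<in> ?S" for n
  proof -
    have "dist x (f n t) \<le> \<bar>t\<bar>" for t
    proof (cases "0 \<le> t \<and> t \<le> dist x (y n)")
      case True
      have 0: "\<gamma> n 0 = x" using \<gamma>[of n] by (simp add: geodesic_from_def)
      have "dist (\<gamma> n 0) (\<gamma> n t) = \<bar>0 - t\<bar>" using True \<gamma>[of n] unfolding geodesic_from_def by auto
      then show ?thesis using True 0 by (simp add: f_def)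
    qed (auto simp: f_def)
    then show ?thesis by auto
  qed
  then have ev: "eventually (\<lambda>g. g \<in> ?S) (filtermap f sequentially)" by (simp add: eventually_filtermap)
  have "filtermap f sequentially \<noteq> bot" by (simp add: filtermap_bot_iff)
  then obtain \<alpha> where \<alpha>: "\<alpha> \<in> ?S" "inf (nhds \<alpha>) (filtermap f sequentially) \<noteq> bot"
    using compact_filter[THEN iffD1, OF comp, rule_format, OF _ ev] by auto
  have approx: "\<exists>n\<ge>m. s \<le> dist x (y n) \<and> t \<le> dist x (y n) \<and> dist (\<gamma> n s) (\<alpha> s) < e \<and> dist (\<gamma> n t) (\<alpha> t) < e"
    if st: "s \<ge> 0" "t \<ge> 0" and e: "e > 0" for s t e m
  proof (rule ccontr)
    assume neg: "\<not> ?thesis"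
    let ?U = "{g. \<forall>i\<in>{s, t}. g (id i) \<in> ball (\<alpha> i) e}"
    have "open ?U" by (intro product_topology_basis') auto
    moreover have "\<alpha> \<in> ?U" using e by simp
    ultimately have near: "eventually (\<lambda>g. g \<in> ?U) (nhds \<alpha>)" by (rule eventually_nhds_in_open)
    have far: "eventually (\<lambda>g. g \<notin> ?U) (filtermap f sequentially)"
    proof -
      have "eventually (\<lambda>n. n \<ge> m \<and> max s t \<le> dist x (y n)) sequentially"
        using inf by (auto simp: filterlim_at_top intro!: eventually_conj eventually_ge_at_top)
      then have "eventually (\<lambda>n. f n \<notin> ?U) sequentially"
      proof (eventually_elim)
        case (elim n)
        then have "f n s = \<gamma> n s" "f n t = \<gamma> n t" using st by (auto simp: f_def)
        moreover have "\<not> (dist (\<gamma> n s) (\<alpha> s) < e \<and> dist (\<gamma> n t) (\<alpha> t) < e)" using neg elim by auto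
        ultimately show ?case by (auto simp: dist_commute)
      qed
      then show ?thesis by (simp add: eventually_filtermap)
    qed
    have "eventually (\<lambda>g. False) (inf (nhds \<alpha>) (filtermap f sequentially))"
      unfolding eventually_inf
      by (rule exI[of _ "\<lambda>g. g \<in> ?U"], rule exI[of _ "\<lambda>g. g \<notin> ?U"]) (use near far in blast)
    then show False using \<alpha>(2) by (simp add: trivial_limit_def)
  qed
  have "dist (\<alpha> s) (\<alpha> t) = \<bar>s - t\<bar>" if st: "s \<ge> 0" "t \<ge> 0" for s t
  proof -
    have "\<bar>dist (\<alpha> s) (\<alpha> t) - \<bar>s - t\<bar>\<bar> \<le> e" if e: "e > 0" for e
    proof -
      obtain n where n: "s \<le> dist x (y n)" "t \<le> dist x (y n)"
        "dist (\<gamma> n s) (\<alpha> s) < e / 2" "dist (\<gamma> n t) (\<alpha> t) < e / 2" using approx[OF st, of "e / 2" 0] e by auto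
      have "dist (\<gamma> n s) (\<gamma> n t) = \<bar>s - t\<bar>" using \<gamma>[of n] n st by (auto simp: geodesic_from_def)
      then show ?thesis
        using n(3,4) dist_perturb[of "\<alpha> s" "\<gamma> n s" "e / 2" "\<alpha> t" "\<gamma> n t" "e / 2"]
        by (simp add: dist_commute)
    qed
    then have "\<bar>dist (\<alpha> s) (\<alpha> t) - \<bar>s - t\<bar>\<bar> \<le> 0" by (rule field_le_epsilon) simp
    then show ?thesis by simp
  qed
  then have ray: "geodesic_ray \<alpha>" by (simp add: geodesic_ray_def)
  have "\<alpha> 0 \<in> cball x \<bar>0\<bar>" by (rule PiE_mem[OF \<alpha>(1)]) simp
  then have "\<alpha> 0 = x" by simp
  from that[OF ray this] show thesis using approx[OF _ _ zero_less_one] by blast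
qed

text \<open>Each further \<open>m\<close> adds at least \<open>2 * E\<close> and loses at most the
  defect \<open>E\<close>; the start \<open>f 0 \<ge> - E\<close> accounts for
  \<open>real j - 1\<close>. A negative \<open>c m\<close> is treated by passing to
  \<open>- c\<close>.\<close>

lemma quasimorphism_growth:
  fixes c :: "int \<Rightarrow> real"
  assumes c: "\<And>m n. \<bar>c (m + n) - c m - c n\<bar> \<le> E" and m: "\<bar>c m\<bar> \<ge> 2 * E"
  shows "\<bar>c (int j * m)\<bar> \<ge> (real j - 1) * E"
proof -
  have *: "f (int j * m) \<ge> (real j - 1) * E"
    if f: "\<And>m n. \<bar>f (m + n) - f m - f n\<bar> \<le> E" and m: "f m \<ge> 2 * E" for f :: "int \<Rightarrow> real"
  proof (induction j)
    case 0
    then show ?case using f[of 0 0] by simp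
  next
    case (Suc j)
    have "int (Suc j) * m = int j * m + m" by (simp add: algebra_simps)
    then show ?case using Suc f[of "int j * m" m] m by (simp add: algebra_simps)
  qed
  show ?thesis
  proof (cases "c m \<ge> 2 * E")
    case True
    then show ?thesis using *[of c] c by fastforce
  next
    case False
    then have "- c m \<ge> 2 * E" using m by linarith
    moreover have "\<bar>- c (m + n) - - c m - - c n\<bar> \<le> E" for m n using c[of m n] by linarith
    ultimately have "- c (int j * m) \<ge> (real j - 1) * E" by (rule *[rotated])
    then show ?thesis by linarith
  qed
qed

lemma finite_hausdorff_rays_sym: "finite_hausdorff_rays \<alpha> \<beta> \<Longrightarrow> finite_hausdorff_rays \<beta> \<alpha>"
  by (auto simp: finite_hausdorff_rays_def dist_commute)

lemma finite_hausdorff_rays_trans: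
  assumes "finite_hausdorff_rays \<alpha> \<beta>" "finite_hausdorff_rays \<beta> \<gamma>"
  shows "finite_hausdorff_rays \<alpha> \<gamma>"
proof -
  obtain D E where D: "\<And>s. s \<ge> 0 \<Longrightarrow> \<exists>t\<ge>0. dist (\<alpha> s) (\<beta> t) \<le> D" "\<And>t. t \<ge> 0 \<Longrightarrow> \<exists>s\<ge>0. dist (\<alpha> s) (\<beta> t) \<le> D"
    and E: "\<And>s. s \<ge> 0 \<Longrightarrow> \<exists>t\<ge>0. dist (\<beta> s) (\<gamma> t) \<le> E" "\<And>t. t \<ge> 0 \<Longrightarrow> \<exists>s\<ge>0. dist (\<beta> s) (\<gamma> t) \<le> E"
    using assms by (auto simp: finite_hausdorff_rays_def)
  have tri: "dist (\<alpha> s) (\<gamma> t) \<le> D + E" if "dist (\<alpha> s) (\<beta> u) \<le> D" "dist (\<beta> u) (\<gamma> t) \<le> E" for s t u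
    using that dist_triangle[of "\<alpha> s" "\<gamma> t" "\<beta> u"] by linarith
  show ?thesis unfolding finite_hausdorff_rays_def using D E tri by metis
qed

lemma finite_hausdorff_rays_pointwise:
  assumes "\<And>s. s \<ge> 0 \<Longrightarrow> dist (\<alpha> s) (\<beta> s) \<le> D"
  shows "finite_hausdorff_rays \<alpha> \<beta>"
  using assms by (auto simp: finite_hausdorff_rays_def)

lemma equiv_ray_equiv: "equiv morse_rays ray_equiv"
proof (rule equivI)
  show "refl_on morse_rays ray_equiv"
    by (auto simp: refl_on_def ray_equiv_def intro!: finite_hausdorff_rays_pointwise[of _ _ 0])
  show "sym ray_equiv" by (auto simp: sym_def ray_equiv_def intro: finite_hausdorff_rays_sym)
  show "trans ray_equiv" unfolding trans_def ray_equiv_def by (blast intro: finite_hausdorff_rays_trans)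
qed (auto simp: ray_equiv_def)

subsection \<open>Proper isometric actions of the integers\<close>

text \<open>The powers of one element, with the group forgotten. \<open>few_returns\<close> is what
  remains of proper discontinuity and cocompactness; its \<open>M\<close> is uniform in
  \<open>x\<close>, so that it applies to points running out along a ray.\<close>

locale proper_int_action =
  fixes a :: "int \<Rightarrow> 'a::metric_space \<Rightarrow> 'a"
  assumes act_0 [simp]: "a 0 x = x"
    and act_add: "a (i + j) x = a i (a j x)"
    and act_dist [simp]: "dist (a i x) (a i y) = dist x y"
    and proper: "proper_space TYPE('a)"
    and geo: "geodesic_space TYPE('a)"
    and few_returns: "\<exists>M. \<forall>x. finite {k. dist x (a k x) \<le> R} \<and> card {k. dist x (a k x) \<le> R} \<le> M"
begin

lemma act_cancel [simp]: "a i (a (- i) x) = x" "a (- i) (a i x) = x"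
  using act_add[of i "- i" x] act_add[of "- i" i x] by simp_all

lemma orbit_dist: "dist (a i x) (a j x) = dist x (a (j - i) x)"
  using act_dist[of i x "a (j - i) x"] act_add[of i "j - i" x] by simp

lemma orbit_dist_minus: "dist x (a (- k) x) = dist x (a k x)"
  using orbit_dist[of k x 0] by (simp add: dist_commute)

lemma orbit_dist_le: "dist x (a k x) \<le> \<bar>real_of_int k\<bar> * dist x (a 1 x)"
proof -
  have nat: "dist x (a (int n) x) \<le> real n * dist x (a 1 x)" for n
  proof (induction n)
    case (Suc n)
    have "dist (a (int n) x) (a (int (Suc n)) x) = dist x (a 1 x)" by (simp add: orbit_dist)
    then show ?case using Suc dist_triangle[of x "a (int (Suc n)) x" "a (int n) x"]
      by (simp add: algebra_simps)
  qed simp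
  show ?thesis
  proof (cases k rule: int_cases2)
    case (nonneg n) then show ?thesis using nat by simp
  next
    case (nonpos n) then show ?thesis using nat by (simp add: orbit_dist_minus)
  qed
qed

lemma translation_pos: "dist x (a 1 x) > 0"
proof (rule ccontr)
  assume "\<not> ?thesis"
  then have "dist x (a k x) \<le> 0" for k using orbit_dist_le[of x k] by simp
  then have "{k. dist x (a k x) \<le> 0} = UNIV" by blast
  moreover obtain M where "finite {k. dist x (a k x) \<le> 0}" using few_returns by blast
  ultimately show False using infinite_UNIV_int by simp
qed

lemma orbit_unbounded:
  assumes "inj k"
  shows "filterlim (\<lambda>n::nat. dist x (a (k n) x)) at_top sequentially"
  unfolding filterlim_at_top
proof
  fix R
  have "finite {i. dist x (a i x) \<le> R}" using few_returns by blast
  then have "finite (k -` {i. dist x (a i x) \<le> R})" using assms by (rule finite_vimageI)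
  then have "eventually (\<lambda>n. n \<notin> k -` {i. dist x (a i x) \<le> R}) cofinite"
    by (simp add: eventually_cofinite)
  then show "eventually (\<lambda>n. R \<le> dist x (a (k n) x)) sequentially"
    unfolding cofinite_eq_sequentially by (rule eventually_mono) auto
qed

lemma act_morse: "N_morse_on N I f \<Longrightarrow> N_morse_on N I (a k \<circ> f)"
  by (rule N_morse_on_isometry[of "a k" "a (- k)"]) simp_all

lemma act_ray: "geodesic_ray \<alpha> \<Longrightarrow> geodesic_ray (a k \<circ> \<alpha>)"
  by (simp add: geodesic_ray_def)

lemma act_morse_rays: "\<alpha> \<in> morse_rays \<Longrightarrow> a k \<circ> \<alpha> \<in> morse_rays"
  unfolding morse_rays_def morse_on_def using act_ray act_morse by blast

lemma act_finite_hausdorff: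
  "finite_hausdorff_rays \<alpha> \<beta> \<Longrightarrow> finite_hausdorff_rays (a k \<circ> \<alpha>) (a k \<circ> \<beta>)"
  by (simp add: finite_hausdorff_rays_def)

lemma act_geodesic_from: "geodesic_from x y \<gamma> \<Longrightarrow> geodesic_from (a k x) (a k y) (a k \<circ> \<gamma>)"
  by (simp add: geodesic_from_def)

lemma act_quasi_geodesic: "quasi_geodesic_on lam eps I q \<Longrightarrow> quasi_geodesic_on lam eps I (a k \<circ> q)"
  by (simp add: quasi_geodesic_on_def)

section \<open>Fixed points on the Morse boundary, rays and orbit segments\<close>

lemma Fix_morse_boundary_iff:
  "C \<in> Fix_morse_boundary (a 1) \<longleftrightarrow>
    (\<exists>\<alpha>\<in>morse_rays. finite_hausdorff_rays (a 1 \<circ> \<alpha>) \<alpha> \<and> C = ray_equiv `` {\<alpha>})"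
proof
  assume "C \<in> Fix_morse_boundary (a 1)"
  then obtain \<alpha> where \<alpha>: "\<alpha> \<in> morse_rays" "C = ray_equiv `` {\<alpha>}" and stable: "boundary_act (a 1) C = C"
    by (auto simp: Fix_morse_boundary_def morse_boundary_def elim: quotientE)
  have "\<alpha> \<in> C" using \<alpha> equiv_class_self[OF equiv_ray_equiv] by blast
  then have "a 1 \<circ> \<alpha> \<in> C" using stable by (auto simp: boundary_act_def)
  then have "finite_hausdorff_rays (a 1 \<circ> \<alpha>) \<alpha>"
    using \<alpha> by (auto simp: ray_equiv_def intro: finite_hausdorff_rays_sym)
  then show "\<exists>\<alpha>\<in>morse_rays. finite_hausdorff_rays (a 1 \<circ> \<alpha>) \<alpha> \<and> C = ray_equiv `` {\<alpha>}"
    using \<alpha> by blast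
next
  assume "\<exists>\<alpha>\<in>morse_rays. finite_hausdorff_rays (a 1 \<circ> \<alpha>) \<alpha> \<and> C = ray_equiv `` {\<alpha>}"
  then obtain \<alpha> where \<alpha>: "\<alpha> \<in> morse_rays" "finite_hausdorff_rays (a 1 \<circ> \<alpha>) \<alpha>" and C: "C = ray_equiv `` {\<alpha>}"
    by blast
  have mem: "\<beta> \<in> C \<longleftrightarrow> \<beta> \<in> morse_rays \<and> finite_hausdorff_rays \<alpha> \<beta>" for \<beta>
    using \<alpha> by (auto simp: C ray_equiv_def)
  have \<alpha>': "finite_hausdorff_rays \<alpha> (a (- 1) \<circ> \<alpha>)"
  proof -
    have "a (- 1) \<circ> (a 1 \<circ> \<alpha>) = \<alpha>" by auto
    then show ?thesis using act_finite_hausdorff[OF \<alpha>(2), of "- 1"] by simp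
  qed
  have "boundary_act (a 1) C = C"
  proof
    show "boundary_act (a 1) C \<subseteq> C"
    proof
      fix \<beta> assume "\<beta> \<in> boundary_act (a 1) C"
      then obtain \<beta>' where \<beta>': "\<beta> = a 1 \<circ> \<beta>'" "\<beta>' \<in> C" by (auto simp: boundary_act_def)
      have "finite_hausdorff_rays \<alpha> (a 1 \<circ> \<beta>')"
        using finite_hausdorff_rays_trans[OF finite_hausdorff_rays_sym[OF \<alpha>(2)] act_finite_hausdorff]
          \<beta>'(2) mem by blast
      then show "\<beta> \<in> C" using \<beta>' mem act_morse_rays by blast
    qed
    show "C \<subseteq> boundary_act (a 1) C"
    proof
      fix \<beta> assume \<beta>: "\<beta> \<in> C"
      have "finite_hausdorff_rays \<alpha> (a (- 1) \<circ> \<beta>)"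
        using finite_hausdorff_rays_trans[OF \<alpha>' act_finite_hausdorff] \<beta> mem by blast
      then have "a (- 1) \<circ> \<beta> \<in> C" using \<beta> mem act_morse_rays by blast
      moreover have "\<beta> = a 1 \<circ> (a (- 1) \<circ> \<beta>)" by auto
      ultimately show "\<beta> \<in> boundary_act (a 1) C" unfolding boundary_act_def by blast
    qed
  qed
  then show "C \<in> Fix_morse_boundary (a 1)"
    using \<alpha> by (auto simp: Fix_morse_boundary_def morse_boundary_def C intro: quotientI)
qed

lemma fixed_ray_act:
  assumes "finite_hausdorff_rays (a 1 \<circ> \<alpha>) \<alpha>"
  shows "finite_hausdorff_rays (a k \<circ> \<alpha>) \<alpha>"
proof -
  have nat: "finite_hausdorff_rays (a (int n) \<circ> \<alpha>) \<alpha>" for n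
  proof (induction n)
    case 0
    have "a (int 0) \<circ> \<alpha> = \<alpha>" by auto
    then show ?case using finite_hausdorff_rays_pointwise[of \<alpha> \<alpha> 0] by simp
  next
    case (Suc n)
    have "a (int (Suc n)) \<circ> \<alpha> = a 1 \<circ> (a (int n) \<circ> \<alpha>)" by (auto simp: act_add[symmetric])
    then show ?case using finite_hausdorff_rays_trans[OF act_finite_hausdorff[OF Suc] assms] by (simp only:)
  qed
  show ?thesis
  proof (cases k rule: int_cases2)
    case (nonneg n) then show ?thesis using nat by simp
  next
    case (nonpos n)
    have "a (- int n) \<circ> (a (int n) \<circ> \<alpha>) = \<alpha>" by auto
    then show ?thesis
      using finite_hausdorff_rays_sym[OF act_finite_hausdorff[OF nat[of n], of "- int n"]] nonpos by simp
  qed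
qed

text \<open>Condition (2) at \<open>x0\<close> in the shape in which the theorem states it, over all
  geodesics because they need not be unique.\<close>

definition morse_orbit_segments :: "'a \<Rightarrow> (real \<Rightarrow> real \<Rightarrow> real) \<Rightarrow> bool" where
  "morse_orbit_segments x0 N0 \<longleftrightarrow> morse_gauge N0 \<and>
    (\<forall>k \<gamma>. geodesic_from x0 (a k x0) \<gamma> \<longrightarrow> N_morse_on N0 {0..dist x0 (a k x0)} \<gamma>)"

text \<open>The translate of \<alpha> by \<open>a k\<close> starts at the same distance
  \<open>?R\<close> from \<open>a k x0\<close> as \<alpha> does from \<open>x0\<close>. The
  Hausdorff bound \<open>D\<close> varies with \<open>k\<close>, the gauge of the ideal triangle
  does not.\<close>

lemma morse_orbit_segments_if_fixed_ray:
  assumes \<alpha>: "\<alpha> \<in> morse_rays" "finite_hausdorff_rays (a 1 \<circ> \<alpha>) \<alpha>"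
  shows "\<exists>N0. morse_orbit_segments x0 N0"
proof -
  obtain N where N: "morse_gauge N" "N_morse_on N {0..} \<alpha>" and ray: "geodesic_ray \<alpha>"
    using \<alpha>(1) by (auto simp: morse_rays_def morse_on_def)
  let ?R = "dist x0 (\<alpha> 0)"
  have side: "morse_gauge (ideal_triangle_gauge N ?R) \<and>
      N_morse_on (ideal_triangle_gauge N ?R) {0..dist x0 (a k x0)} \<gamma>"
    if \<gamma>: "geodesic_from x0 (a k x0) \<gamma>" for k \<gamma>
  proof -
    obtain D where D: "\<And>t. t \<ge> 0 \<Longrightarrow> \<exists>s\<ge>0. dist ((a k \<circ> \<alpha>) t) (\<alpha> s) \<le> D"
      using fixed_ray_act[OF \<alpha>(2), of k] by (auto simp: finite_hausdorff_rays_def)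
    have near: "\<exists>s\<ge>0. dist x0 (\<alpha> s) \<le> ?R" "\<exists>s\<ge>0. dist (a k x0) ((a k \<circ> \<alpha>) s) \<le> ?R" by auto
    show ?thesis
      using ideal_triangle_side_morse[OF geo N(1) zero_le_dist ray N(2) act_ray[OF ray] act_morse[OF N(2)]
        D \<gamma> near] by blast
  qed
  obtain \<eta> where "geodesic_from x0 (a 0 x0) \<eta>" using geo unfolding geodesic_space_def by blast
  then have "morse_orbit_segments x0 (ideal_triangle_gauge N ?R)"
    unfolding morse_orbit_segments_def using side by blast
  then show ?thesis by blast
qed

text \<open>The exponents \<open>k\<close> are arbitrary so that both ends of the orbit can be
  reached. Since \<open>a 1\<close> commutes with \<open>a (k n)\<close>, it moves both ends of
  \<open>\<gamma> n\<close> by \<open>L\<close>; being Morse, \<open>\<gamma> n\<close> fellow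
  travels its translate, and this survives in the limit.\<close>

lemma orbit_limit_ray:
  assumes N0: "morse_orbit_segments x0 N0" and k: "inj (k :: nat \<Rightarrow> int)"
  obtains \<alpha> where "\<alpha> \<in> morse_rays" "finite_hausdorff_rays (a 1 \<circ> \<alpha>) \<alpha>" "\<alpha> 0 = x0"
    "\<And>s. s \<ge> 0 \<Longrightarrow> \<exists>n \<gamma>. geodesic_from x0 (a (k n) x0) \<gamma> \<and> s \<le> dist x0 (a (k n) x0) \<and> dist (\<gamma> s) (\<alpha> s) \<le> 1"
proof -
  have N: "morse_gauge N0" using N0 by (simp add: morse_orbit_segments_def)
  have "\<forall>n. \<exists>\<gamma>. geodesic_from x0 (a (k n) x0) \<gamma>" using geo unfolding geodesic_space_def by blast
  then obtain \<gamma> where \<gamma>: "\<And>n. geodesic_from x0 (a (k n) x0) (\<gamma> n)" by metis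
  let ?l = "\<lambda>n. dist x0 (a (k n) x0)"
  have \<gamma>m: "N_morse_on N0 {0..?l n} (\<gamma> n)" for n using N0 \<gamma> by (simp add: morse_orbit_segments_def)
  note \<gamma>q = geodesic_from_quasi_geodesic[OF \<gamma>]
  obtain \<alpha> where ray: "geodesic_ray \<alpha>" and \<alpha>0: "\<alpha> 0 = x0"
    and approx: "\<And>s t m. s \<ge> 0 \<Longrightarrow> t \<ge> 0 \<Longrightarrow> \<exists>n\<ge>m. s \<le> ?l n \<and> t \<le> ?l n \<and>
       dist (\<gamma> n s) (\<alpha> s) < 1 \<and> dist (\<gamma> n t) (\<alpha> t) < 1"
    using geodesic_limit_ray[OF proper \<gamma> orbit_unbounded[OF k]] by blast
  have "N_morse_on (close_gauge N0 1 0 1 0 1) {0..} \<alpha>"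
  proof (rule morse_of_pairwise_near_morse[OF N _ _ _ _ _ geodesic_ray_quasi_geodesic[OF ray]])
    fix c d :: real assume "c \<in> {0..}" "d \<in> {0..}"
    then have "c \<ge> 0" "d \<ge> 0" by auto
    from approx[OF this, of 0] obtain n where n: "c \<le> ?l n" "d \<le> ?l n"
      "dist (\<gamma> n c) (\<alpha> c) < 1" "dist (\<gamma> n d) (\<alpha> d) < 1" by blast
    have "\<exists>s\<in>{0..?l n}. dist (\<alpha> c) (\<gamma> n s) \<le> 1" "\<exists>s\<in>{0..?l n}. dist (\<alpha> d) (\<gamma> n s) \<le> 1"
      using n \<open>c \<ge> 0\<close> \<open>d \<ge> 0\<close> by (auto simp: dist_commute intro: less_imp_le)
    then show "\<exists>J f. quasi_geodesic_on 1 0 J f \<and> N_morse_on N0 J f \<and>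
        (\<exists>s\<in>J. dist (\<alpha> c) (f s) \<le> 1) \<and> (\<exists>s\<in>J. dist (\<alpha> d) (f s) \<le> 1)"
      using \<gamma>m \<gamma>q by blast
  qed auto
  moreover have "morse_gauge (close_gauge N0 1 0 1 0 1)" by (rule morse_gauge_close_gauge[OF N]) auto
  ultimately have \<alpha>: "\<alpha> \<in> morse_rays" using ray by (auto simp: morse_rays_def morse_on_def)
  define L C where "L = dist x0 (a 1 x0)" and "C = close_gauge N0 1 0 1 0 L 1 0"
  have "dist ((a 1 \<circ> \<alpha>) s) (\<alpha> s) \<le> 2 * C + L + 2" if s: "s \<ge> 0" for s
  proof -
    obtain n where n: "s \<le> ?l n" "dist (\<gamma> n s) (\<alpha> s) < 1" using approx[OF s s, of 0] by blast
    have e: "\<gamma> n 0 = x0" "\<gamma> n (?l n) = a (k n) x0" using \<gamma>[of n] by (auto simp: geodesic_from_def)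
    have comm: "a 1 (a (k n) x0) = a (k n) (a 1 x0)" by (simp add: act_add[symmetric] add.commute)
    have "\<exists>u\<in>{0..?l n}. dist (\<gamma> n s) ((a 1 \<circ> \<gamma> n) u) \<le> close_gauge N0 1 0 1 0 L 1 0"
    proof (rule quasi_geodesics_close[OF N _ _ _ _ _ _ _ \<gamma>q \<gamma>m \<gamma>q _ act_quasi_geodesic[OF \<gamma>q]])
      show "dist (\<gamma> n 0) ((a 1 \<circ> \<gamma> n) 0) \<le> L" "dist (\<gamma> n (?l n)) ((a 1 \<circ> \<gamma> n) (?l n)) \<le> L"
        using e comm by (auto simp: L_def)
      have "L \<ge> 0" by (simp add: L_def)
      then show "\<exists>s\<in>{0..?l n}. dist (\<gamma> n 0) (\<gamma> n s) \<le> L" "\<exists>s\<in>{0..?l n}. dist (\<gamma> n (?l n)) (\<gamma> n s) \<le> L"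
        by (auto intro: bexI[of _ 0] bexI[of _ "?l n"])
    qed (use s n in \<open>auto simp: L_def\<close>)
    then obtain u where u: "u \<in> {0..?l n}" "dist (\<gamma> n s) (a 1 (\<gamma> n u)) \<le> C" by (auto simp: C_def)
    have par: "dist x0 (\<gamma> n v) = v" if "v \<in> {0..?l n}" for v
    proof -
      have "dist (\<gamma> n 0) (\<gamma> n v) = \<bar>0 - v\<bar>" using \<gamma>[of n] that unfolding geodesic_from_def by auto
      then show ?thesis using e that by simp
    qed
    have m: "s \<in> {0..?l n}" using s n by simp
    \<comment> \<open>Comparing distances from \<open>x0\<close> and from \<open>a 1 x0\<close>
      turns closeness to some point of the translate into closeness to the point with the same
      parameter.\<close>
    have "\<bar>dist x0 (\<gamma> n s) - dist (a 1 x0) (a 1 (\<gamma> n u))\<bar> \<le> L + C"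
      by (rule dist_perturb) (use u in \<open>auto simp: L_def\<close>)
    then have "\<bar>s - u\<bar> \<le> L + C" using par[OF m] par[OF u(1)] by simp
    moreover have "dist (\<gamma> n s) (\<gamma> n u) = \<bar>s - u\<bar>"
      using \<gamma>[of n] m u(1) unfolding geodesic_from_def by blast
    ultimately have "dist (\<gamma> n s) (a 1 (\<gamma> n s)) \<le> 2 * C + L"
      using u(2) dist_triangle2[of "\<gamma> n s" "a 1 (\<gamma> n s)" "a 1 (\<gamma> n u)"] act_dist[of 1 "\<gamma> n s" "\<gamma> n u"] by linarith
    moreover have "\<bar>dist (\<alpha> s) (a 1 (\<alpha> s)) - dist (\<gamma> n s) (a 1 (\<gamma> n s))\<bar> \<le> 1 + 1"
      by (rule dist_perturb) (use n in \<open>auto simp: dist_commute\<close>)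
    ultimately show ?thesis by (simp add: dist_commute)
  qed
  then have "finite_hausdorff_rays (a 1 \<circ> \<alpha>) \<alpha>" by (rule finite_hausdorff_rays_pointwise)
  moreover have "\<exists>n \<gamma>. geodesic_from x0 (a (k n) x0) \<gamma> \<and> s \<le> dist x0 (a (k n) x0) \<and> dist (\<gamma> s) (\<alpha> s) \<le> 1"
    if s: "s \<ge> 0" for s
    using approx[OF s s, of 0] \<gamma> less_imp_le by blast
  ultimately show thesis using that \<alpha> \<alpha>0 by blast
qed

section \<open>Linear growth of the orbit\<close>

lemma orbit_undistorted:
  assumes \<alpha>: "\<alpha> \<in> morse_rays" "finite_hausdorff_rays (a 1 \<circ> \<alpha>) \<alpha>"
  obtains A B where "A > 0" "\<And>k. A * \<bar>real_of_int k\<bar> - B \<le> dist x0 (a k x0)"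
proof -
  obtain N where N: "morse_gauge N" "N_morse_on N {0..} \<alpha>" and ray: "geodesic_ray \<alpha>"
    using \<alpha>(1) by (auto simp: morse_rays_def morse_on_def)
  define D where "D = 3 * N 9 4"
  have D0: "D \<ge> 0" using N(1) by (simp add: D_def morse_gauge_def)
  have "\<exists>c T. \<forall>t\<ge>T. t \<ge> 0 \<and> t + c \<ge> 0 \<and> dist (a k (\<alpha> t)) (\<alpha> (t + c)) \<le> D" for k
  proof -
    obtain E where "\<And>t. t \<ge> 0 \<Longrightarrow> \<exists>s\<ge>0. dist ((a k \<circ> \<alpha>) t) (\<alpha> s) \<le> E"
      using fixed_ray_act[OF \<alpha>(2), of k] by (auto simp: finite_hausdorff_rays_def)
    from asymptotic_rays_shift[OF geo act_ray[OF ray] ray N(2) this]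
    show ?thesis by (simp add: D_def)
  qed
  then obtain c T where shift: "\<And>k t. t \<ge> T k \<Longrightarrow> t \<ge> 0 \<and> t + c k \<ge> 0 \<and> dist (a k (\<alpha> t)) (\<alpha> (t + c k)) \<le> D"
    by metis
  have \<alpha>d: "dist (\<alpha> s) (\<alpha> t) = \<bar>s - t\<bar>" if "s \<ge> 0" "t \<ge> 0" for s t
    using ray that by (simp add: geodesic_ray_def)
  \<comment> \<open>\<open>3 * D\<close> is the defect found below; the extra 1 makes
    \<open>E\<close> positive even when \<open>D = 0\<close>.\<close>
  define E where "E = 3 * D + 1"
  have E0: "E > 0" using D0 by (simp add: E_def)
  have quasi: "\<bar>c (m + n) - c m - c n\<bar> \<le> E" for m n
  proof -
    \<comment> \<open>Large enough to apply \<open>shift\<close> to \<open>m + n\<close> and to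
      \<open>n\<close> at \<open>t\<close>, and to \<open>m\<close> at
      \<open>t + c n\<close>.\<close>
    define t where "t = \<bar>T (m + n)\<bar> + \<bar>T n\<bar> + \<bar>T m\<bar> + \<bar>c n\<bar>"
    have t: "t \<ge> T (m + n)" "t \<ge> T n" "t + c n \<ge> T m" by (auto simp: t_def)
    have 1: "dist (a (m + n) (\<alpha> t)) (\<alpha> (t + c (m + n))) \<le> D" "t + c (m + n) \<ge> 0"
      using shift[OF t(1)] by auto
    have 2: "dist (a m (a n (\<alpha> t))) (a m (\<alpha> (t + c n))) \<le> D" using shift[OF t(2)] by simp
    have 3: "dist (a m (\<alpha> (t + c n))) (\<alpha> (t + c n + c m)) \<le> D" "t + c n + c m \<ge> 0"
      using shift[OF t(3)] by auto
    have "dist (\<alpha> (t + c (m + n))) (\<alpha> (t + c n + c m)) \<le> 3 * D"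
      using 1(1) 2 3(1) unfolding act_add by metric
    then show ?thesis using \<alpha>d[OF 1(2) 3(2)] by (simp add: E_def)
  qed
  have unbounded: "\<exists>k. \<bar>c k\<bar> > R" for R
  proof (rule ccontr)
    assume "\<not> ?thesis"
    then have R: "\<bar>c k\<bar> \<le> R" for k by (simp add: not_less)
    obtain M where M: "\<And>x. finite {k. dist x (a k x) \<le> D + R}" "\<And>x. card {k. dist x (a k x) \<le> D + R} \<le> M"
      using few_returns by blast
    \<comment> \<open>Beyond the thresholds of all exponents in \<open>{0..int M}\<close>; there are
      \<open>M + 1\<close> of them, one more than \<open>M\<close> allows.\<close>
    define t where "t = (\<Sum>k\<in>{0..int M}. \<bar>T k\<bar>)"
    have "dist (\<alpha> t) (a k (\<alpha> t)) \<le> D + R" if k: "k \<in> {0..int M}" for k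
    proof -
      have "\<bar>T k\<bar> \<le> t" unfolding t_def using k by (intro member_le_sum) auto
      then have s: "t \<ge> 0" "t + c k \<ge> 0" "dist (a k (\<alpha> t)) (\<alpha> (t + c k)) \<le> D" using shift[of k t] by auto
      have "dist (\<alpha> t) (\<alpha> (t + c k)) \<le> R" using \<alpha>d[OF s(1,2)] R[of k] by simp
      then show ?thesis using s(3) dist_triangle2[of "\<alpha> t" "a k (\<alpha> t)" "\<alpha> (t + c k)"] by linarith
    qed
    then have "card {0..int M} \<le> card {k. dist (\<alpha> t) (a k (\<alpha> t)) \<le> D + R}"
      by (intro card_mono M(1)) blast
    then show False using M(2)[of "\<alpha> t"] by simp
  qed
  \<comment> \<open>\<open>a k (\<alpha> t)\<close> is at distance \<open>t\<close> from
    \<open>a k (\<alpha> 0)\<close>, while the nearby point \<open>\<alpha> (t + c k)\<close> is at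
    distance \<open>t + c k\<close> from \<open>\<alpha> 0\<close>.\<close>
  have shift_le: "\<bar>c k\<bar> \<le> dist x0 (a k x0) + 2 * dist x0 (\<alpha> 0) + D" for k
  proof -
    define t where "t = \<bar>T k\<bar>"
    have s: "t \<ge> 0" "t + c k \<ge> 0" "dist (a k (\<alpha> t)) (\<alpha> (t + c k)) \<le> D"
      using shift[of k t] by (auto simp: t_def)
    have "\<bar>dist (a k (\<alpha> 0)) (a k (\<alpha> t)) - dist (\<alpha> 0) (\<alpha> (t + c k))\<bar> \<le> dist (a k (\<alpha> 0)) (\<alpha> 0) + D"
      by (rule dist_perturb) (use s in auto)
    then have "\<bar>c k\<bar> \<le> dist (a k (\<alpha> 0)) (\<alpha> 0) + D" using \<alpha>d[OF _ s(1), of 0] \<alpha>d[OF _ s(2), of 0] s by simp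
    moreover have "\<bar>dist (a k (\<alpha> 0)) (\<alpha> 0) - dist (a k x0) x0\<bar> \<le> dist x0 (\<alpha> 0) + dist x0 (\<alpha> 0)"
      by (rule dist_perturb) (auto simp: dist_commute)
    ultimately show ?thesis by (simp add: dist_commute)
  qed
  obtain m0 where m0: "\<bar>c m0\<bar> > 2 * E" using unbounded by blast
  \<comment> \<open>The exponent found may be negative; orbit distances are even in the exponent, so
    its absolute value serves.\<close>
  define m where "m = nat \<bar>m0\<bar>"
  have "c 0 \<le> E" "c 0 \<ge> - E" using quasi[of 0 0] by auto
  then have "m0 \<noteq> 0" using m0 E0 by auto
  then have m: "m > 0" by (simp add: m_def)
  define B0 where "B0 = 2 * dist x0 (\<alpha> 0) + D"
  have multiple: "(real j - 1) * E - B0 \<le> dist x0 (a (int j * int m) x0)" for j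
  proof -
    have "(real j - 1) * E - B0 \<le> dist x0 (a (int j * m0) x0)"
      using quasimorphism_growth[OF quasi, of m0 j] m0 shift_le[of "int j * m0"] by (simp add: B0_def)
    moreover have "int j * int m = int j * m0 \<or> int j * int m = - (int j * m0)" by (auto simp: m_def abs_if)
    ultimately show ?thesis by (metis orbit_dist_minus)
  qed
  define L where "L = dist x0 (a 1 x0)"
  have L: "L > 0" unfolding L_def by (rule translation_pos)
  \<comment> \<open>Division by \<open>m\<close>: the remainder costs at most \<open>m * L\<close>,
    and the gap between \<open>j - 1\<close> and \<open>j + 1\<close> costs
    \<open>2 * E\<close>.\<close>
  have nat: "E / m * real n - (2 * E + B0 + m * L) \<le> dist x0 (a (int n) x0)" for n
  proof -
    define j r where "j = n div m" and "r = n mod m"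
    have n: "n = j * m + r" "r < m" using m by (auto simp: j_def r_def)
    have "dist x0 (a (int j * int m) x0) \<le> dist x0 (a (int n) x0) + dist (a (int n) x0) (a (int j * int m) x0)"
      by (rule dist_triangle)
    moreover have "dist (a (int n) x0) (a (int j * int m) x0) = dist x0 (a (int r) x0)"
      using orbit_dist_minus[of x0 "int r"] by (simp add: orbit_dist n(1))
    moreover have "dist x0 (a (int r) x0) \<le> real r * L" using orbit_dist_le[of x0 "int r"] by (simp add: L_def)
    moreover have "real r * L \<le> m * L" using n(2) L by (intro mult_right_mono) auto
    moreover have "E / m * real n \<le> E * (real j + 1)"
    proof -
      have "real n \<le> real m * (real j + 1)" using n by (simp add: algebra_simps)
      then have "E / m * real n \<le> E / m * (real m * (real j + 1))" using E0 by (intro mult_left_mono) auto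
      also have "\<dots> = E * (real j + 1)" using m by simp
      finally show ?thesis .
    qed
    ultimately show ?thesis using multiple[of j] by (simp add: algebra_simps)
  qed
  show thesis
  proof (rule that)
    show "E / m > 0" using E0 m by simp
    show "E / m * \<bar>real_of_int k\<bar> - (2 * E + B0 + m * L) \<le> dist x0 (a k x0)" for k
      by (cases k rule: int_cases2) (use nat orbit_dist_minus in auto)
  qed
qed

section \<open>The bi-infinite orbit path and its two ends\<close>

definition orbit_path :: "'a \<Rightarrow> (real \<Rightarrow> 'a) \<Rightarrow> real \<Rightarrow> 'a" where
  "orbit_path x0 \<eta> = concat_path (dist x0 (a 1 x0)) (\<lambda>k. a k \<circ> \<eta>)"

lemma orbit_path_near_orbit:
  assumes \<eta>: "geodesic_from x0 (a 1 x0) \<eta>"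
  shows "dist (orbit_path x0 \<eta> t) (a \<lfloor>t / dist x0 (a 1 x0)\<rfloor> x0) \<le> dist x0 (a 1 x0)"
proof -
  define L i where "L = dist x0 (a 1 x0)" and "i = \<lfloor>t / L\<rfloor>"
  have L: "L > 0" unfolding L_def by (rule translation_pos)
  have "of_int i \<le> t / L" "t / L \<le> of_int i + 1" by (auto simp: i_def)
  then have r: "t - of_int i * L \<in> {0..L}" using L by (simp add: field_simps)
  have "dist (\<eta> (t - of_int i * L)) (\<eta> 0) = \<bar>t - of_int i * L - 0\<bar>"
    using \<eta> r L unfolding geodesic_from_def L_def[symmetric] by auto
  moreover have "\<eta> 0 = x0" using \<eta> by (simp add: geodesic_from_def)
  moreover have "orbit_path x0 \<eta> t = a i (\<eta> (t - of_int i * L))"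
    by (simp add: orbit_path_def concat_path_def Let_def i_def L_def)
  ultimately show ?thesis using r by (simp flip: L_def i_def)
qed

lemma orbit_path_orbit:
  assumes \<eta>: "geodesic_from x0 (a 1 x0) \<eta>"
  shows "orbit_path x0 \<eta> (of_int k * dist x0 (a 1 x0)) = a k x0"
  using \<eta> translation_pos[of x0] by (simp add: orbit_path_def concat_path_def Let_def geodesic_from_def)

lemma orbit_path_quasi_geodesic:
  assumes \<eta>: "geodesic_from x0 (a 1 x0) \<eta>"
    and A: "A > 0" "\<And>k. A * \<bar>real_of_int k\<bar> - B \<le> dist x0 (a k x0)"
  shows "\<exists>lam eps. lam \<ge> 1 \<and> eps \<ge> 0 \<and> quasi_geodesic_on lam eps UNIV (orbit_path x0 \<eta>)"
proof -
  define L where "L = dist x0 (a 1 x0)"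
  have L: "L > 0" unfolding L_def by (rule translation_pos)
  \<comment> \<open>A gain of \<open>A\<close> per step of length \<open>L\<close> gives the slope
    \<open>A / L\<close>. In \<open>eps\<close>, \<open>3 * L\<close> covers the distances to the
    orbit at both ends and one rounding of the number of steps; \<open>A + \<bar>B\<bar>\<close> is
    the loss in the lower bound.\<close>
  define lam eps where "lam = max 1 (L / A)" and "eps = A + \<bar>B\<bar> + 3 * L"
  have lam: "lam \<ge> 1" "L / A \<le> lam" by (auto simp: lam_def)
  let ?h = "orbit_path x0 \<eta>"
  have "\<bar>s - t\<bar> / lam - eps \<le> dist (?h s) (?h t) \<and> dist (?h s) (?h t) \<le> lam * \<bar>s - t\<bar> + eps" for s t
  proof -
    define i j where "i = \<lfloor>s / L\<rfloor>" and "j = \<lfloor>t / L\<rfloor>"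
    define X U K where "X = dist x0 (a (j - i) x0)" and "U = \<bar>s - t\<bar>" and "K = \<bar>real_of_int (j - i)\<bar>"
    have "\<bar>dist (?h s) (?h t) - dist (a i x0) (a j x0)\<bar> \<le> L + L"
      unfolding i_def j_def L_def by (intro dist_perturb orbit_path_near_orbit[OF \<eta>])
    then have hX: "\<bar>dist (?h s) (?h t) - X\<bar> \<le> 2 * L" by (simp add: orbit_dist X_def)
    have "\<bar>s / L - t / L\<bar> = U / L" using L by (simp add: U_def diff_divide_distrib[symmetric])
    moreover have "\<bar>K - \<bar>s / L - t / L\<bar>\<bar> \<le> 1" unfolding K_def i_def j_def by linarith
    ultimately have K: "\<bar>K - U / L\<bar> \<le> 1" by simp
    then have K': "K \<le> U / L + 1" "U / L - 1 \<le> K" by (auto simp: abs_le_iff)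
    have "X \<le> K * L" using orbit_dist_le[of x0 "j - i"] by (simp add: X_def K_def L_def)
    also have "\<dots> \<le> (U / L + 1) * L" using K' L by (intro mult_right_mono) auto
    also have "\<dots> = U + L" using L by (simp add: field_simps)
    finally have up: "X \<le> U + L" .
    have "A * (U / L - 1) \<le> A * K" using K' A by (intro mult_left_mono) auto
    then have low: "A * (U / L) - A - B \<le> X" using A(2)[of "j - i"] by (simp add: X_def K_def algebra_simps)
    have U: "U \<ge> 0" by (simp add: U_def)
    have "U / lam \<le> U / (L / A)" using lam U L A by (intro divide_left_mono) auto
    then have "U / lam \<le> A * (U / L)" by (simp add: mult.commute)
    moreover have "U \<le> lam * U" using mult_right_mono[OF lam(1) U] by simp
    ultimately have "U / lam - eps \<le> dist (?h s) (?h t) \<and> dist (?h s) (?h t) \<le> lam * U + eps"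
      using hX up low A L unfolding eps_def abs_le_iff by linarith
    then show ?thesis by (simp add: U_def)
  qed
  moreover have "eps \<ge> 0" using A L by (simp add: eps_def)
  ultimately show ?thesis using lam by (auto simp: quasi_geodesic_on_def)
qed

text \<open>For \<open>c\<close> and \<open>d\<close> the comparison geodesic is the translate by
  \<open>a i\<close> of a segment from \<open>x0\<close> to \<open>a (j - i) x0\<close>; its ends
  are the orbit points just before \<open>c\<close> and \<open>d\<close>, and one gauge
  \<open>N0\<close> serves all pairs.\<close>

lemma orbit_path_morse:
  assumes N0: "morse_orbit_segments x0 N0" and \<eta>: "geodesic_from x0 (a 1 x0) \<eta>"
    and h: "quasi_geodesic_on lam eps UNIV (orbit_path x0 \<eta>)" "lam \<ge> 1" "eps \<ge> 0"
  shows "\<exists>N. morse_gauge N \<and> N_morse_on N UNIV (orbit_path x0 \<eta>)"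
proof -
  let ?L = "dist x0 (a 1 x0)"
  have N: "morse_gauge N0" using N0 by (simp add: morse_orbit_segments_def)
  have "N_morse_on (close_gauge N0 1 0 lam eps ?L) UNIV (orbit_path x0 \<eta>)"
  proof (rule morse_of_pairwise_near_morse[OF N _ _ h(2,3) zero_le_dist h(1)])
    fix c d :: real
    define i j where "i = \<lfloor>c / ?L\<rfloor>" and "j = \<lfloor>d / ?L\<rfloor>"
    obtain \<gamma> where \<gamma>: "geodesic_from x0 (a (j - i) x0) \<gamma>" using geo unfolding geodesic_space_def by blast
    let ?I = "{0..dist x0 (a (j - i) x0)}"
    have "N_morse_on N0 ?I (a i \<circ> \<gamma>)" using N0 \<gamma> by (intro act_morse) (simp add: morse_orbit_segments_def)
    moreover have "quasi_geodesic_on 1 0 ?I (a i \<circ> \<gamma>)"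
      by (intro act_quasi_geodesic geodesic_from_quasi_geodesic \<gamma>)
    moreover have "(a i \<circ> \<gamma>) 0 = a i x0" "(a i \<circ> \<gamma>) (dist x0 (a (j - i) x0)) = a j x0"
      using \<gamma> by (auto simp: geodesic_from_def act_add[symmetric])
    then have "dist (orbit_path x0 \<eta> c) ((a i \<circ> \<gamma>) 0) \<le> ?L"
      "dist (orbit_path x0 \<eta> d) ((a i \<circ> \<gamma>) (dist x0 (a (j - i) x0))) \<le> ?L"
      using orbit_path_near_orbit[OF \<eta>] by (simp_all only: i_def j_def)
    moreover have "0 \<in> ?I" "dist x0 (a (j - i) x0) \<in> ?I" by auto
    ultimately show "\<exists>J f. quasi_geodesic_on 1 0 J f \<and> N_morse_on N0 J f \<and>
        (\<exists>s\<in>J. dist (orbit_path x0 \<eta> c) (f s) \<le> ?L) \<and> (\<exists>s\<in>J. dist (orbit_path x0 \<eta> d) (f s) \<le> ?L)"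
      by blast
  qed auto
  moreover have "morse_gauge (close_gauge N0 1 0 lam eps ?L)"
    by (rule morse_gauge_close_gauge[OF N]) (use h in auto)
  ultimately show ?thesis by blast
qed

text \<open>A geodesic from \<open>x0\<close> to \<open>a k x0\<close> is a
  \<open>(1, 0)\<close>-quasi-geodesic with ends on the orbit path, hence within
  \<open>N 1 0\<close> of it; the pairwise criterion then makes it Morse itself.\<close>

lemma morse_orbit_segments_if_orbit_path_morse:
  assumes \<eta>: "geodesic_from x0 (a 1 x0) \<eta>" and h: "morse_quasi_geodesic_on UNIV (orbit_path x0 \<eta>)"
  shows "\<exists>N0. morse_orbit_segments x0 N0"
proof -
  obtain lam eps N where q: "lam \<ge> 1" "eps \<ge> 0" "quasi_geodesic_on lam eps UNIV (orbit_path x0 \<eta>)"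
    and N: "morse_gauge N" "N_morse_on N UNIV (orbit_path x0 \<eta>)"
    using h by (auto simp: morse_quasi_geodesic_on_def morse_on_def)
  define R where "R = N 1 0"
  have R: "R \<ge> 0" using N(1) by (simp add: R_def morse_gauge_def)
  have "N_morse_on (close_gauge N lam eps 1 0 R) {0..dist x0 (a k x0)} \<gamma>"
    if \<gamma>: "geodesic_from x0 (a k x0) \<gamma>" for k \<gamma>
  proof (rule morse_of_pairwise_near_morse[OF N(1) q(1,2) _ _ R geodesic_from_quasi_geodesic[OF \<gamma>]])
    have "\<gamma> 0 = a 0 x0" "\<gamma> (dist x0 (a k x0)) = a k x0" using \<gamma> by (auto simp: geodesic_from_def)
    then have "\<gamma> 0 \<in> range (orbit_path x0 \<eta>)" "\<gamma> (dist x0 (a k x0)) \<in> range (orbit_path x0 \<eta>)"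
      by (metis orbit_path_orbit[OF \<eta>] rangeI)+
    then have "\<exists>s\<in>UNIV. dist (\<gamma> t) (orbit_path x0 \<eta> s) \<le> R" if "t \<in> {0..dist x0 (a k x0)}" for t
      using N(2) geodesic_from_quasi_geodesic[OF \<gamma>] that unfolding N_morse_on_def R_def
      by (meson order_refl zero_le_dist)
    then show "\<exists>J f. quasi_geodesic_on lam eps J f \<and> N_morse_on N J f \<and>
        (\<exists>s\<in>J. dist (\<gamma> c) (f s) \<le> R) \<and> (\<exists>s\<in>J. dist (\<gamma> d) (f s) \<le> R)"
      if "c \<in> {0..dist x0 (a k x0)}" "d \<in> {0..dist x0 (a k x0)}" for c d
      using q(3) N(2) that by blast
  qed auto
  then show ?thesis
    using morse_gauge_close_gauge[OF N(1) q(1,2) _ _ R] unfolding morse_orbit_segments_def by blast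
qed

text \<open>\<sigma> selects the half. Here \<gamma> is both the Morse reference and the path under
  study: it shares its ends with a stretch of the orbit path starting at parameter 0, so
  \<open>R = 0\<close> and the nearby parameter lies on that half.\<close>

lemma segment_near_half_orbit_path:
  assumes N0: "morse_orbit_segments x0 N0" and \<eta>: "geodesic_from x0 (a 1 x0) \<eta>"
    and h: "quasi_geodesic_on lam eps UNIV (orbit_path x0 \<eta>)" "lam \<ge> 1" "eps \<ge> 0"
    and \<gamma>: "geodesic_from x0 (a k x0) \<gamma>" and s: "s \<in> {0..dist x0 (a k x0)}"
    and \<sigma>: "\<sigma> = 1 \<and> k \<ge> 0 \<or> \<sigma> = - 1 \<and> k \<le> 0"
  shows "\<exists>u\<ge>0. dist (\<gamma> s) (orbit_path x0 \<eta> (\<sigma> * u)) \<le> close_gauge N0 1 0 lam eps 0 1 0"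
proof -
  let ?L = "dist x0 (a 1 x0)" and ?l = "dist x0 (a k x0)"
  define m where "m = \<bar>real_of_int k\<bar> * ?L"
  let ?h = "\<lambda>u. orbit_path x0 \<eta> (\<sigma> * u)"
  have N: "morse_gauge N0" "N_morse_on N0 {0..?l} \<gamma>" using N0 \<gamma> by (auto simp: morse_orbit_segments_def)
  have e: "\<gamma> 0 = x0" "\<gamma> ?l = a k x0" using \<gamma> by (auto simp: geodesic_from_def)
  have "\<sigma> * m = of_int k * ?L" using \<sigma> by (auto simp: m_def)
  then have h1: "?h m = a k x0" using orbit_path_orbit[OF \<eta>] by simp
  have h0: "?h 0 = x0" using orbit_path_orbit[OF \<eta>, of 0] by simp
  have q: "quasi_geodesic_on lam eps {0..m} ?h"
  proof -
    have "\<bar>\<sigma> * u - \<sigma> * v\<bar> = \<bar>u - v\<bar>" for u v using \<sigma> by auto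
    then show ?thesis using h(1) by (simp add: quasi_geodesic_on_def is_interval_cc) metis
  qed
  have "\<exists>u\<in>{0..m}. dist (\<gamma> s) (?h u) \<le> close_gauge N0 1 0 lam eps 0 1 0"
    by (rule quasi_geodesics_close[OF N(1) _ _ h(2,3) _ _ _ geodesic_from_quasi_geodesic[OF \<gamma>] N(2)
          geodesic_from_quasi_geodesic[OF \<gamma>] _ q])
      (use s e h0 h1 in \<open>auto simp: m_def intro: bexI[of _ 0] bexI[of _ ?l]\<close>)
  then show ?thesis by auto
qed

text \<open>Limits along positive and along negative powers stay near opposite halves of the orbit
  path. Were they asymptotic, its points at \<open>u\<close> and \<open>- v\<close> would be a
  bounded distance apart, which bounds \<open>u + v\<close>, hence \<open>u\<close>, hence the
  parameter \<open>s\<close> on the ray.\<close>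

lemma two_fixed_points:
  assumes "Fix_morse_boundary (a 1) \<noteq> {}"
  shows "\<exists>P Q. P \<in> Fix_morse_boundary (a 1) \<and> Q \<in> Fix_morse_boundary (a 1) \<and> P \<noteq> Q"
proof -
  obtain \<alpha> where \<alpha>: "\<alpha> \<in> morse_rays" "finite_hausdorff_rays (a 1 \<circ> \<alpha>) \<alpha>"
    using assms Fix_morse_boundary_iff by blast
  define x0 where "x0 = \<alpha> 0"
  obtain N0 where N0: "morse_orbit_segments x0 N0" using morse_orbit_segments_if_fixed_ray[OF \<alpha>] by blast
  obtain A B where AB: "A > 0" "\<And>k. A * \<bar>real_of_int k\<bar> - B \<le> dist x0 (a k x0)"
    using orbit_undistorted[OF \<alpha>] by blast
  obtain \<eta> where \<eta>: "geodesic_from x0 (a 1 x0) \<eta>" using geo unfolding geodesic_space_def by blast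
  obtain lam eps where h: "quasi_geodesic_on lam eps UNIV (orbit_path x0 \<eta>)" "lam \<ge> 1" "eps \<ge> 0"
    using orbit_path_quasi_geodesic[OF \<eta> AB] by blast
  define C where "C = close_gauge N0 1 0 lam eps 0 1 0 + 1"
  let ?h = "orbit_path x0 \<eta>"
  have limit: "\<exists>\<beta>. \<beta> \<in> morse_rays \<and> finite_hausdorff_rays (a 1 \<circ> \<beta>) \<beta> \<and> \<beta> 0 = x0 \<and>
      (\<forall>s\<ge>0. \<exists>u\<ge>0. dist (\<beta> s) (?h (\<sigma> * u)) \<le> C)"
    if k: "inj k" "\<And>n::nat. \<sigma> = 1 \<and> k n \<ge> 0 \<or> \<sigma> = - 1 \<and> k n \<le> 0" for k :: "nat \<Rightarrow> int" and \<sigma> :: real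
  proof -
    obtain \<beta> where \<beta>: "\<beta> \<in> morse_rays" "finite_hausdorff_rays (a 1 \<circ> \<beta>) \<beta>" "\<beta> 0 = x0"
      and app: "\<And>s. s \<ge> 0 \<Longrightarrow> \<exists>n \<gamma>. geodesic_from x0 (a (k n) x0) \<gamma> \<and> s \<le> dist x0 (a (k n) x0) \<and> dist (\<gamma> s) (\<beta> s) \<le> 1"
      using orbit_limit_ray[OF N0 k(1)] by blast
    have "\<exists>u\<ge>0. dist (\<beta> s) (?h (\<sigma> * u)) \<le> C" if s: "s \<ge> 0" for s
    proof -
      obtain n \<gamma> where \<gamma>: "geodesic_from x0 (a (k n) x0) \<gamma>" "s \<le> dist x0 (a (k n) x0)" "dist (\<gamma> s) (\<beta> s) \<le> 1"
        using app[OF s] by blast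
      have m: "s \<in> {0..dist x0 (a (k n) x0)}" using s \<gamma> by simp
      obtain u where u: "u \<ge> 0" "dist (\<gamma> s) (?h (\<sigma> * u)) \<le> close_gauge N0 1 0 lam eps 0 1 0"
        using segment_near_half_orbit_path[OF N0 \<eta> h \<gamma>(1) m k(2)] by blast
      then have "dist (\<beta> s) (?h (\<sigma> * u)) \<le> C"
        using \<gamma>(3) dist_triangle3[of "\<beta> s" "?h (\<sigma> * u)" "\<gamma> s"] by (simp add: C_def)
      then show ?thesis using u by blast
    qed
    then show ?thesis using \<beta> by blast
  qed
  have "inj (\<lambda>n. int n)" "inj (\<lambda>n. - int n)" by (auto simp: inj_def)
  from limit[OF this(1), of 1] limit[OF this(2), of "- 1"]
  obtain \<beta>p \<beta>m where p: "\<beta>p \<in> morse_rays" "finite_hausdorff_rays (a 1 \<circ> \<beta>p) \<beta>p" "\<beta>p 0 = x0"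
      "\<And>s. s \<ge> 0 \<Longrightarrow> \<exists>u\<ge>0. dist (\<beta>p s) (?h u) \<le> C"
    and m: "\<beta>m \<in> morse_rays" "finite_hausdorff_rays (a 1 \<circ> \<beta>m) \<beta>m"
      "\<And>s. s \<ge> 0 \<Longrightarrow> \<exists>u\<ge>0. dist (\<beta>m s) (?h (- u)) \<le> C"
    by auto
  have "\<not> finite_hausdorff_rays \<beta>p \<beta>m"
  proof
    assume "finite_hausdorff_rays \<beta>p \<beta>m"
    then obtain D where D: "\<And>s. s \<ge> 0 \<Longrightarrow> \<exists>t\<ge>0. dist (\<beta>p s) (\<beta>m t) \<le> D"
      by (auto simp: finite_hausdorff_rays_def)
    define E where "E = lam * (lam * (2 * C + D + eps)) + eps"
    have bound: "s \<le> C + E" if s: "s \<ge> 0" for s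
    proof -
      obtain t where t: "t \<ge> 0" "dist (\<beta>p s) (\<beta>m t) \<le> D" using D[OF s] by blast
      obtain u where u: "u \<ge> 0" "dist (\<beta>p s) (?h u) \<le> C" using p(4)[OF s] by blast
      obtain v where v: "v \<ge> 0" "dist (\<beta>m t) (?h (- v)) \<le> C" using m(3)[OF t(1)] by blast
      have "dist (?h u) (?h (- v)) + eps \<le> 2 * C + D + eps" using t u v by metric
      then have "lam * (dist (?h u) (?h (- v)) + eps) \<le> lam * (2 * C + D + eps)"
        using h(2) by (intro mult_left_mono) auto
      then have "\<bar>u - - v\<bar> \<le> lam * (2 * C + D + eps)"
        using quasi_geodesic_on_param_dist[OF h(1) _ _ h(2), of u "- v"] by simp
      then have "u \<le> lam * (2 * C + D + eps)" using u v by linarith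
      then have "lam * u \<le> lam * (lam * (2 * C + D + eps))" using h(2) by (intro mult_left_mono) auto
      moreover have "dist (?h u) (?h 0) \<le> lam * u + eps"
        using quasi_geodesic_onD(2)[OF h(1), of u 0] u by simp
      moreover have "?h 0 = x0" using orbit_path_orbit[OF \<eta>, of 0] by simp
      moreover have "dist (\<beta>p s) (\<beta>p 0) = s" using p(1) s by (simp add: morse_rays_def geodesic_ray_def)
      ultimately show ?thesis
        using u(2) p(3) dist_triangle[of "\<beta>p s" x0 "?h u"] by (simp add: E_def)
    qed
    \<comment> \<open>The instance at 0 gives \<open>C + E \<ge> 0\<close>, so
      \<open>C + E + 1\<close> is an admissible value of \<open>s\<close> that violates the
      bound.\<close>
    from bound[of 0] bound[of "C + E + 1"] show False by linarith
  qed
  then have "ray_equiv `` {\<beta>p} \<noteq> ray_equiv `` {\<beta>m}"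
    using eq_equiv_class[OF _ equiv_ray_equiv m(1)] by (auto simp: ray_equiv_def)
  then show ?thesis using Fix_morse_boundary_iff p m by blast
qed

text \<open>The left side does not mention \<open>x0\<close>, which yields the passage from some
  basepoint to every basepoint.\<close>

lemma fixed_point_iff_morse_orbit_segments:
  "Fix_morse_boundary (a 1) \<noteq> {} \<longleftrightarrow> (\<exists>N0. morse_orbit_segments x0 N0)"
proof
  assume "Fix_morse_boundary (a 1) \<noteq> {}"
  then show "\<exists>N0. morse_orbit_segments x0 N0"
    using Fix_morse_boundary_iff morse_orbit_segments_if_fixed_ray by blast
next
  assume "\<exists>N0. morse_orbit_segments x0 N0"
  then obtain N0 where N0: "morse_orbit_segments x0 N0" by blast
  obtain \<alpha> where "\<alpha> \<in> morse_rays" "finite_hausdorff_rays (a 1 \<circ> \<alpha>) \<alpha>"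
    by (rule orbit_limit_ray[OF N0, of int]) (simp, blast)
  then show "Fix_morse_boundary (a 1) \<noteq> {}" using Fix_morse_boundary_iff by blast
qed

lemma fixed_point_iff_orbit_path_morse:
  "Fix_morse_boundary (a 1) \<noteq> {} \<longleftrightarrow>
    (\<forall>x0 \<eta>. geodesic_from x0 (a 1 x0) \<eta> \<longrightarrow> morse_quasi_geodesic_on UNIV (orbit_path x0 \<eta>))"
proof
  assume "Fix_morse_boundary (a 1) \<noteq> {}"
  then obtain \<alpha> where \<alpha>: "\<alpha> \<in> morse_rays" "finite_hausdorff_rays (a 1 \<circ> \<alpha>) \<alpha>"
    using Fix_morse_boundary_iff by blast
  show "\<forall>x0 \<eta>. geodesic_from x0 (a 1 x0) \<eta> \<longrightarrow> morse_quasi_geodesic_on UNIV (orbit_path x0 \<eta>)"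
  proof (intro allI impI)
    fix x0 \<eta> assume \<eta>: "geodesic_from x0 (a 1 x0) \<eta>"
    obtain N0 where N0: "morse_orbit_segments x0 N0" using morse_orbit_segments_if_fixed_ray[OF \<alpha>] by blast
    obtain A B where AB: "A > 0" "\<And>k. A * \<bar>real_of_int k\<bar> - B \<le> dist x0 (a k x0)"
      using orbit_undistorted[OF \<alpha>] by blast
    obtain lam eps where h: "quasi_geodesic_on lam eps UNIV (orbit_path x0 \<eta>)" "lam \<ge> 1" "eps \<ge> 0"
      using orbit_path_quasi_geodesic[OF \<eta> AB] by blast
    then show "morse_quasi_geodesic_on UNIV (orbit_path x0 \<eta>)"
      using orbit_path_morse[OF N0 \<eta> h] unfolding morse_quasi_geodesic_on_def morse_on_def by blast
  qed
next
  assume morse: "\<forall>x0 \<eta>. geodesic_from x0 (a 1 x0) \<eta> \<longrightarrow> morse_quasi_geodesic_on UNIV (orbit_path x0 \<eta>)"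
  fix x0 :: 'a
  obtain \<eta> where "geodesic_from x0 (a 1 x0) \<eta>" using geo unfolding geodesic_space_def by blast
  then show "Fix_morse_boundary (a 1) \<noteq> {}"
    using morse morse_orbit_segments_if_orbit_path_morse fixed_point_iff_morse_orbit_segments by blast
qed

end

section \<open>From a geometric action to the powers of one element\<close>

text \<open>Write \<open>x = \<phi> h y\<close> with \<open>y\<close> in the compact
  \<open>K\<close>. Conjugation by \<open>h\<close> turns returns of \<open>x\<close> into elements
  moving \<open>y\<close> by at most \<open>R\<close>; these make the ball \<open>?C\<close> meet
  its image, so there are at most \<open>card ?F\<close> of them wherever \<open>x\<close>
  lies.\<close>

lemma geometric_action_few_returns:
  fixes \<phi> :: "'g \<Rightarrow> 'a::metric_space \<Rightarrow> 'a"
  assumes proper: "proper_space TYPE('a)" and act: "geometric_action G \<phi>" and f: "inj_on f S" "f ` S \<subseteq> carrier G"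
  shows "\<exists>M. \<forall>x. finite {k\<in>S. dist x (\<phi> (f k) x) \<le> R} \<and> card {k\<in>S. dist x (\<phi> (f k) x) \<le> R} \<le> M"
proof -
  interpret group_action G UNIV \<phi> using act by (simp add: geometric_action_def)
  interpret group G using group_hom by (simp add: group_hom_def)
  have iso: "\<And>g x y. g \<in> carrier G \<Longrightarrow> dist (\<phi> g x) (\<phi> g y) = dist x y"
    and disc: "\<And>K. compact K \<Longrightarrow> finite {g \<in> carrier G. \<phi> g ` K \<inter> K \<noteq> {}}"
    using act by (auto simp: geometric_action_def)
  obtain K where K: "compact K" "(\<Union>g\<in>carrier G. \<phi> g ` K) = UNIV" using act by (auto simp: geometric_action_def)
  obtain z e where e: "\<And>y. y \<in> K \<Longrightarrow> dist z y \<le> e" using compact_imp_bounded[OF K(1)] by (auto simp: bounded_def)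
  let ?C = "cball z (e + \<bar>R\<bar>)"
  let ?F = "{g \<in> carrier G. \<phi> g ` ?C \<inter> ?C \<noteq> {}}"
  have F: "finite ?F" using disc proper by (simp add: proper_space_def)
  have "finite {k\<in>S. dist x (\<phi> (f k) x) \<le> R} \<and> card {k\<in>S. dist x (\<phi> (f k) x) \<le> R} \<le> card ?F" for x
  proof -
    let ?A = "{k\<in>S. dist x (\<phi> (f k) x) \<le> R}"
    have "x \<in> (\<Union>g\<in>carrier G. \<phi> g ` K)" using K(2) by simp
    then obtain h y where h: "h \<in> carrier G" "y \<in> K" "x = \<phi> h y" by blast
    have hi: "inv\<^bsub>G\<^esub> h \<in> carrier G" using h by simp
    let ?c = "\<lambda>k. inv\<^bsub>G\<^esub> h \<otimes>\<^bsub>G\<^esub> (f k \<otimes>\<^bsub>G\<^esub> h)"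
    have "inj_on ?c ?A"
    proof (rule inj_onI)
      fix k l assume kl: "k \<in> ?A" "l \<in> ?A" "?c k = ?c l"
      then have fc: "f k \<in> carrier G" "f l \<in> carrier G" using f(2) by auto
      then have "f k = f l" using kl(3) h hi by simp
      then show "k = l" using kl f(1) by (auto dest: inj_onD)
    qed
    moreover have "?c ` ?A \<subseteq> ?F"
    proof
      fix g assume "g \<in> ?c ` ?A"
      then obtain k where k: "k \<in> S" "dist x (\<phi> (f k) x) \<le> R" "g = ?c k" by auto
      have fk: "f k \<in> carrier G" using k f(2) by auto
      have gy: "\<phi> g y = \<phi> (inv\<^bsub>G\<^esub> h) (\<phi> (f k) x)"
        using h hi fk by (simp add: k(3) composition_rule)
      have "y = \<phi> (inv\<^bsub>G\<^esub> h) x" using orbit_sym_aux[OF h(1) _ h(3)[symmetric]] by simp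
      then have "dist y (\<phi> g y) = dist x (\<phi> (f k) x)" using iso[OF hi] gy by simp
      then have "dist z (\<phi> g y) \<le> e + \<bar>R\<bar>" "dist z y \<le> e + \<bar>R\<bar>"
        using e[OF h(2)] k(2) dist_triangle[of z "\<phi> g y" y] by linarith+
      then have "y \<in> ?C" "\<phi> g y \<in> ?C" by auto
      then have "\<phi> g y \<in> \<phi> g ` ?C \<inter> ?C" by blast
      moreover have "g \<in> carrier G" using fk h hi k(3) by simp
      ultimately show "g \<in> ?F" by blast
    qed
    ultimately show ?thesis using F by (meson card_inj_on_le finite_imageD finite_subset)
  qed
  then show ?thesis by blast
qed

lemma (in group) inj_int_pow:
  assumes g: "g \<in> carrier G" and inf: "\<forall>n::nat. n > 0 \<longrightarrow> g [^] n \<noteq> \<one>"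
  shows "inj (\<lambda>k::int. g [^] k)"
proof (rule linorder_injI)
  fix i j :: int assume "i < j"
  have "nat (j - i) > 0" using \<open>i < j\<close> by simp
  with inf have "g [^] nat (j - i) \<noteq> \<one>" by blast
  moreover have "g [^] nat (j - i) = g [^] (j - i)" using \<open>i < j\<close> by (intro pow_nat) simp
  ultimately have "g [^] (j - i) \<noteq> \<one>" by simp
  then show "g [^] i \<noteq> g [^] j" using g by (auto simp: int_pow_diff)
qed

theorem theorem4p6:
  fixes G :: "('g, 'b) monoid_scheme" and \<phi> :: "'g \<Rightarrow> 'a::metric_space \<Rightarrow> 'a" and g :: 'g
  assumes "group G"
    and "proper_space TYPE('a)"
    and "geodesic_space TYPE('a)"
    and "geometric_action G \<phi>"
    and "g \<in> carrier G"
    and "\<forall>n::nat. n > 0 \<longrightarrow> g [^]\<^bsub>G\<^esub> n \<noteq> \<one>\<^bsub>G\<^esub>"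
  shows
   "(Fix_morse_boundary (\<phi> g) \<noteq> {}
      \<longleftrightarrow> (\<exists>x0. \<exists>N0. morse_gauge N0 \<and>
             (\<forall>k::int. \<forall>\<gamma>. geodesic_from x0 (\<phi> (g [^]\<^bsub>G\<^esub> k) x0) \<gamma> \<longrightarrow>
                 N_morse_on N0 {0..dist x0 (\<phi> (g [^]\<^bsub>G\<^esub> k) x0)} \<gamma>)))
  \<and> (Fix_morse_boundary (\<phi> g) \<noteq> {}
      \<longleftrightarrow> (\<forall>x0. \<exists>N0. morse_gauge N0 \<and>
             (\<forall>k::int. \<forall>\<gamma>. geodesic_from x0 (\<phi> (g [^]\<^bsub>G\<^esub> k) x0) \<gamma> \<longrightarrow>
                 N_morse_on N0 {0..dist x0 (\<phi> (g [^]\<^bsub>G\<^esub> k) x0)} \<gamma>)))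
  \<and> (Fix_morse_boundary (\<phi> g) \<noteq> {}
      \<longleftrightarrow> ((\<forall>x0 \<eta>. geodesic_from x0 (\<phi> g x0) \<eta> \<longrightarrow>
              morse_quasi_geodesic_on UNIV
                (concat_path (dist x0 (\<phi> g x0)) (\<lambda>k. \<phi> (g [^]\<^bsub>G\<^esub> k) \<circ> \<eta>)))
           \<and> (\<forall>x0. morse_isometry_wrt G \<phi> g x0)))
  \<and> (Fix_morse_boundary (\<phi> g) \<noteq> {}
      \<longleftrightarrow> (\<exists>P Q. P \<in> Fix_morse_boundary (\<phi> g) \<and> Q \<in> Fix_morse_boundary (\<phi> g) \<and> P \<noteq> Q))"
proof -
  define a where "a k = \<phi> (g [^]\<^bsub>G\<^esub> k)" for k :: int
  interpret G: group G by fact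
  interpret A: group_action G UNIV \<phi> using assms(4) by (simp add: geometric_action_def)
  interpret proper_int_action a
  proof
    show "a 0 x = x" for x using A.id_eq_one by (metis a_def int_pow_0 UNIV_I restrict_apply')
    show "a (i + j) x = a i (a j x)" for i j x
      using assms(5) by (simp add: a_def G.int_pow_mult A.composition_rule)
    show "dist (a i x) (a i y) = dist x y" for i x y
      using assms(4,5) by (simp add: a_def geometric_action_def)
    show "\<exists>M. \<forall>x. finite {k. dist x (a k x) \<le> R} \<and> card {k. dist x (a k x) \<le> R} \<le> M" for R
      using geometric_action_few_returns[OF assms(2,4) G.inj_int_pow[OF assms(5,6)], of R] assms(5)
      by (auto simp: a_def)
  qed fact+
  have a1: "\<phi> g = a 1" using assms(5) by (simp add: a_def)
  \<comment> \<open>The translates \<open>a i \<circ> \<eta>\<close> of a single geodesic are the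
    segments that \<open>morse_isometry_wrt\<close> asks for.\<close>
  have iso: "morse_isometry_wrt G \<phi> g x0"
    if "\<forall>x0 \<eta>. geodesic_from x0 (a 1 x0) \<eta> \<longrightarrow> morse_quasi_geodesic_on UNIV (orbit_path x0 \<eta>)" for x0
  proof -
    obtain \<eta> where \<eta>: "geodesic_from x0 (a 1 x0) \<eta>" using geo unfolding geodesic_space_def by blast
    then have "morse_quasi_geodesic_on UNIV (orbit_path x0 \<eta>)" using that by blast
    then obtain N lam eps where "morse_gauge N" "N_morse_on N UNIV (orbit_path x0 \<eta>)"
      and "lam \<ge> 1" "eps \<ge> 0" "quasi_geodesic_on lam eps UNIV (orbit_path x0 \<eta>)"
      unfolding morse_quasi_geodesic_on_def morse_on_def by blast
    moreover have "geodesic_from (a i x0) (a (i + 1) x0) (a i \<circ> \<eta>)" for i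
      unfolding act_add by (rule act_geodesic_from[OF \<eta>])
    ultimately show ?thesis
      unfolding morse_isometry_wrt_def orbit_path_def a1 a_def[symmetric]
      by (intro exI[of _ N] exI[of _ "\<lambda>i. a i \<circ> \<eta>"]) blast
  qed
  show ?thesis
    unfolding a1 a_def[symmetric] morse_orbit_segments_def[symmetric] orbit_path_def[symmetric]
    using fixed_point_iff_morse_orbit_segments fixed_point_iff_orbit_path_morse iso two_fixed_points
    by (intro conjI) blast+
qed

end
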